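(* Let $G$ be a simple undirected connected graph on $\{1,\dots,N\}$, $N\ge 2$, with adjacency matrix $A=[a_{\ell k}]$ and combinatorial Laplacian $L$, whose largest eigenvalue is $\lambda_{\max}(L)$. Let $\mu>0$ and assume $$0<c<c^*:=\frac{2\mu}{3\sqrt{3N}\,\lambda_{\max}(L)}.$$ Let $r^*$ denote the smaller positive root of $\mu x-x^3=c\sqrt{N\mu}\,\lambda_{\max}(L)$. Assume $\omega_\ell=\omega\in\mathbb R$ for all $\ell$. Let $z=(z_1,\dots,z_N)$ be a solution of $$\dot z_\ell=(\mu+\mathrm i\omega)z_\ell-|z_\ell|^2z_\ell+c\sum_{k=1}^N a_{\ell k}(z_k-z_\ell),\qquad \ell=1,\dots,N,$$ whose initial data $z_\ell(0)=r_\ell(0)e^{\mathrm i\theta_\ell(0)}$ satisfy $$\sum_{\ell=1}^N r_\ell^2(0)<N\mu,\qquad r_\ell(0)>r^*,\qquad 0<\theta_\ell(0)<\pi,\qquad \ell=1,\dots,N.$$ Then the solution exists globally for $t\ge 0$ and the network achieves complete synchronization. More precisely, there exists $\vartheta_0\in(0,\pi)$ such that for all $\ell,k\in\{1,\dots,N\}$ $$\lim_{t\to\infty}r_\ell(t)=\sqrt\mu,\quad \lim_{t\to\infty}|\dot r_\ell(t)-\dot r_k(t)|=0,\quad \lim_{t\to\infty}|\dot\theta_\ell(t)-\dot\theta_k(t)|=0,\quad \lim_{t\to\infty}\operatorname{dist}_{\mathbb S^1}(\theta_\ell(t)-\omega t,\vartheta_0)=0.$$ Equivalently, $\lim_{t\to\infty}\left|z_\ell(t)-\sqrt\mu\,e^{\mathrm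 i(\omega t+\vartheta_0)}\right|=0$ for $\ell=1,\dots,N$. Moreover, for all $\ell,k\in\{1,\dots,N\}$ the convergences $r_\ell(t)\to\sqrt\mu$, $|\dot r_\ell(t)-\dot r_k(t)|\to0$, $|\dot\theta_\ell(t)-\dot\theta_k(t)|\to0$, $\operatorname{dist}_{\mathbb S^1}(\theta_\ell(t)-\omega t,\vartheta_0)\to0$ and $\left|z_\ell(t)-\sqrt\mu\,e^{\mathrm i(\omega t+\vartheta_0)}\right|\to0$ as $t\to\infty$ all occur at an exponential rate; hence the network attains exponential complete synchronization.
   Context: Graph conventions: $a_{\ell k}\in\{0,1\}$, $a_{\ell\ell}=0$, $a_{\ell k}=a_{k\ell}$; $d_\ell=\sum_k a_{\ell k}$, $D=\mathrm{diag}(d_1,\dots,d_N)$, $L=D-A$. Polar coordinates: $r_\ell(t)=|z_\ell(t)|$, and on any time interval where $r_\ell>0$, $\theta_\ell$ is an unwrapped angle, i.e. a continuous real-valued function with $z_\ell(t)=r_\ell(t)e^{\mathrm i\theta_\ell(t)}$ (with the given value $\theta_\ell(0)$). The circular distance is $\operatorname{dist}_{\mathbb S^1}(\alpha,\beta)=\min_{m\in\mathbb Z}|\alpha-\beta+2\pi m|\in[0,\pi]$. Complete synchronization of a solution (defined when $r_\ell(t)>0$ for all $t\ge0$ and all $\ell$, so that the phases are globally defined) means that for all $\ell,k$, as $t\to\infty$: $|r_\ell-r_k|\to0$, $|\dot r_\ell-\dot r_k|\to0$, $|\dot\theta_\ell-\dot\theta_k|\to0$ and $\operatorname{dist}_{\mathbb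 S^1}(\theta_\ell,\theta_k)\to0$. It is exponential if these convergences are exponential. A quantity $q(t)$ converges to $q_\infty$ at an exponential rate if there exist constants $C,\gamma>0$ such that the distance from $q(t)$ to $q_\infty$ is at most $Ce^{-\gamma t}$ for all $t\ge0$. *)

theory Defs
  imports "HOL-Analysis.Analysis"
begin

text \<open>The vertex set \<open>{1, \<dots>, N}\<close> is the finite index type \<^typ>\<open>'n\<close>, with \<open>N = CARD('n)\<close>.\<close>

definition simple_graph_adjacency :: "real ^ 'n ^ 'n \<Rightarrow> bool" where
  "simple_graph_adjacency A \<longleftrightarrow>
     (\<forall>l k. A $ l $ k \<in> {0, 1}) \<and> (\<forall>l. A $ l $ l = 0) \<and> (\<forall>l k. A $ l $ k = A $ k $ l)"

definition graph_connected :: "real ^ 'n ^ 'n \<Rightarrow> bool" where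
  "graph_connected A \<longleftrightarrow> (\<forall>l k. (l, k) \<in> {(i, j). A $ i $ j = 1}\<^sup>*)"

definition degree_matrix :: "real ^ 'n ^ 'n \<Rightarrow> real ^ 'n ^ 'n" where
  "degree_matrix A = (\<chi> l k. if l = k then (\<Sum>j\<in>UNIV. A $ l $ j) else 0)"

definition laplacian :: "real ^ 'n ^ 'n \<Rightarrow> real ^ 'n ^ 'n" where
  "laplacian A = degree_matrix A - A"

text \<open>Real eigenvalues only; these are all the eigenvalues of a symmetric matrix such as the
  Laplacian, for which the maximum below is therefore over a finite nonempty set.\<close>

definition real_eigenvalues :: "real ^ 'n ^ 'n \<Rightarrow> real set" where
  "real_eigenvalues M = {a. \<exists>v. v \<noteq> 0 \<and> M *v v = a *\<^sub>R v}"

definition lambda_max :: "real ^ 'n ^ 'n \<Rightarrow> real" where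
  "lambda_max M = Max (real_eigenvalues M)"

definition c_star :: "real ^ 'n ^ 'n \<Rightarrow> real \<Rightarrow> real" where
  "c_star A \<mu> = 2 * \<mu> / (3 * sqrt (3 * real CARD('n)) * lambda_max (laplacian A))"

text \<open>For \<open>0 < c < c_star A \<mu>\<close> the cubic has exactly two positive roots.\<close>

definition r_star :: "real ^ 'n ^ 'n \<Rightarrow> real \<Rightarrow> real \<Rightarrow> real" where
  "r_star A \<mu> c =
     Min {x. 0 < x \<and> \<mu> * x - x ^ 3 = c * sqrt (real CARD('n) * \<mu>) * lambda_max (laplacian A)}"

text \<open>Solutions live on an arbitrary set \<open>J\<close> of times; at an endpoint of \<open>J\<close> the derivative is
  one-sided.\<close>

definition network_solution ::
  "real ^ 'n ^ 'n \<Rightarrow> real \<Rightarrow> real \<Rightarrow> ('n \<Rightarrow> real) \<Rightarrow> real set \<Rightarrow> ('n \<Rightarrow> real \<Rightarrow> complex) \<Rightarrow> bool" where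
  "network_solution A \<mu> c \<omega> J z \<longleftrightarrow>
     (\<forall>t\<in>J. \<forall>l. (z l has_vector_derivative
        ((complex_of_real \<mu> + \<i> * complex_of_real (\<omega> l)) * z l t
         - complex_of_real ((cmod (z l t))\<^sup>2) * z l t
         + complex_of_real c * (\<Sum>k\<in>UNIV. complex_of_real (A $ l $ k) * (z k t - z l t))))
        (at t within J))"

text \<open>Global existence is phrased as: a solution on any interval \<open>J \<subseteq> {0..}\<close> containing 0 extends to
  \<open>{0..}\<close>. The degenerate case \<open>J = {0}\<close> only prescribes initial data, since every function has
  every derivative at 0 within \<open>{0}\<close>.\<close>

definition global_extension ::
  "real ^ 'n ^ 'n \<Rightarrow> real \<Rightarrow> real \<Rightarrow> ('n \<Rightarrow> real) \<Rightarrow> real set \<Rightarrow> ('n \<Rightarrow> real \<Rightarrow> complex)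
     \<Rightarrow> ('n \<Rightarrow> real \<Rightarrow> complex) \<Rightarrow> bool" where
  "global_extension A \<mu> c \<omega> J z Z \<longleftrightarrow>
     network_solution A \<mu> c \<omega> {0..} Z \<and> (\<forall>t\<in>J. \<forall>l. Z l t = z l t)"

definition amplitude :: "('n \<Rightarrow> real \<Rightarrow> complex) \<Rightarrow> 'n \<Rightarrow> real \<Rightarrow> real" where
  "amplitude z l t = cmod (z l t)"

definition unwrapped_phases ::
  "('n \<Rightarrow> real \<Rightarrow> complex) \<Rightarrow> ('n \<Rightarrow> real) \<Rightarrow> ('n \<Rightarrow> real \<Rightarrow> real) \<Rightarrow> bool" where
  "unwrapped_phases z \<theta>0 \<theta> \<longleftrightarrow>
     (\<forall>l. continuous_on {0..} (\<theta> l) \<and> \<theta> l 0 = \<theta>0 l \<and>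
          (\<forall>t\<ge>0. z l t = rcis (amplitude z l t) (\<theta> l t)))"

definition time_deriv :: "(real \<Rightarrow> real) \<Rightarrow> real \<Rightarrow> real" where
  "time_deriv f t = vector_derivative f (at t within {0..})"

text \<open>The infimum over the integers is attained, so it is the minimum.\<close>

definition circle_dist :: "real \<Rightarrow> real \<Rightarrow> real" where
  "circle_dist \<alpha> \<beta> = (INF m::int. \<bar>\<alpha> - \<beta> + 2 * pi * real_of_int m\<bar>)"

definition exp_converges :: "(real \<Rightarrow> real) \<Rightarrow> real \<Rightarrow> bool" where
  "exp_converges q q0 \<longleftrightarrow> (\<exists>C>0. \<exists>\<gamma>>0. \<forall>t\<ge>0. \<bar>q t - q0\<bar> \<le> C * exp (- \<gamma> * t))"

text \<open>The requirements that make the notion meaningful: positive amplitudes for all times, and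
  derivatives that exist (otherwise \<^const>\<open>time_deriv\<close> is an unspecified value).\<close>

definition polar_regular :: "('n \<Rightarrow> real \<Rightarrow> complex) \<Rightarrow> ('n \<Rightarrow> real \<Rightarrow> real) \<Rightarrow> bool" where
  "polar_regular z \<theta> \<longleftrightarrow>
     (\<forall>t\<ge>0. \<forall>l. 0 < amplitude z l t \<and>
        amplitude z l differentiable (at t within {0..}) \<and>
        \<theta> l differentiable (at t within {0..}))"

definition complete_synchronization ::
  "('n \<Rightarrow> real \<Rightarrow> complex) \<Rightarrow> ('n \<Rightarrow> real \<Rightarrow> real) \<Rightarrow> bool" where
  "complete_synchronization z \<theta> \<longleftrightarrow> polar_regular z \<theta> \<and>
     (\<forall>l k.
        ((\<lambda>t. \<bar>amplitude z l t - amplitude z k t\<bar>) \<longlongrightarrow> 0) at_top \<and>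
        ((\<lambda>t. \<bar>time_deriv (amplitude z l) t - time_deriv (amplitude z k) t\<bar>) \<longlongrightarrow> 0) at_top \<and>
        ((\<lambda>t. \<bar>time_deriv (\<theta> l) t - time_deriv (\<theta> k) t\<bar>) \<longlongrightarrow> 0) at_top \<and>
        ((\<lambda>t. circle_dist (\<theta> l t) (\<theta> k t)) \<longlongrightarrow> 0) at_top)"

definition exp_complete_synchronization ::
  "('n \<Rightarrow> real \<Rightarrow> complex) \<Rightarrow> ('n \<Rightarrow> real \<Rightarrow> real) \<Rightarrow> bool" where
  "exp_complete_synchronization z \<theta> \<longleftrightarrow> complete_synchronization z \<theta> \<and>
     (\<forall>l k.
        exp_converges (\<lambda>t. \<bar>amplitude z l t - amplitude z k t\<bar>) 0 \<and>
        exp_converges (\<lambda>t. \<bar>time_deriv (amplitude z l) t - time_deriv (amplitude z k) t\<bar>) 0 \<and>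
        exp_converges (\<lambda>t. \<bar>time_deriv (\<theta> l) t - time_deriv (\<theta> k) t\<bar>) 0 \<and>
        exp_converges (\<lambda>t. circle_dist (\<theta> l t) (\<theta> k t)) 0)"

end

theory Submission
  imports Defs
begin

text \<open>
  In the frame that rotates with the common frequency, \<open>w l t = cis (- \<Omega> * t) * z l t\<close>, the
  frequency disappears from the equation, and the claim becomes exponential convergence of all
  \<open>w l\<close> to one point of modulus \<open>sqrt \<mu>\<close> in the open upper half-plane.

  Two a priori bounds hold for all times.  The coupling dissipates the total energy
  \<open>\<Sum>l. (cmod (w l))\<^sup>2\<close> and the cubic damping limits its growth, so it stays below \<open>N * \<mu>\<close> (\<open>total_energy_bound\<close>).  Hence
  the coupling force on a node has modulus less than \<open>c * lambda_max (laplacian A) * sqrt (N * \<mu>)\<close>, and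
  \<open>r_star\<close> is precisely an amplitude at which the reaction term \<open>\<mu> * r - r ^ 3\<close> equals this
  bound, so no amplitude can come down to it (\<open>amplitude_lower\<close>).

  The phases are controlled by the cotangents \<open>\<rho> l = Re (w l) / Im (w l)\<close>.  All imaginary parts
  stay positive, and since the reaction term acts on both coordinates by the same
  real factor, it cancels from the derivative of the quotient: \<open>\<rho>\<close> solves the linear consensus
  equation with weights \<open>c * A l k * Im (w k) / Im (w l)\<close> (\<open>rho_der\<close>).  The maximum principle bounds
  \<open>\<rho>\<close>, which together with the lower bound on the amplitudes bounds the imaginary
  parts away from 0; then the weights on edges are bounded from both sides, and connectedness of the
  graph makes the spread of \<open>\<rho>\<close> contract by a fixed factor over a fixed time
  (\<open>consensus_exponential\<close>).

  Once the phases agree up to an exponentially small error, the coupling cannot raise the largest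
  amplitude and can lower the smallest one only by that error, so the squared
  amplitudes are squeezed between the barriers \<open>\<mu> \<plusminus> C * exp (- \<kappa> * t)\<close>
  (\<open>square_amplitude_converges\<close>).  The derivatives of amplitudes and phases are given by the
  equation and inherit the rate.

  Global existence follows from a Picard iteration for a truncated, globally Lipschitz field: the
  energy bound keeps its solution where the truncation is inactive.  Uniqueness, which
  identifies this solution with a given one on \<open>J\<close>, follows from the monotonicity of the cubic term.
\<close>

section \<open>Calculus of barriers and monotonicity\<close>

lemma nonincreasing_of_deriv_nonpos:
  fixes f :: "real \<Rightarrow> real"
  assumes "a \<le> b"
    and der: "\<And>t. a \<le> t \<Longrightarrow> t \<le> b \<Longrightarrow> (f has_real_derivative f' t) (at t within {a..b})"
    and nonpos: "\<And>t. a \<le> t \<Longrightarrow> t \<le> b \<Longrightarrow> f' t \<le> 0"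
  shows "f b \<le> f a"
proof -
  have "\<exists>t\<in>{a..b}. f b - f a = (\<lambda>h. f' t * h) (b - a)"
    using der by (intro mvt_very_simple[OF \<open>a \<le> b\<close>]) (auto simp: has_field_derivative_def)
  then obtain t where "t \<in> {a..b}" "f b - f a = f' t * (b - a)" by auto
  moreover have "f' t * (b - a) \<le> 0"
    using nonpos[of t] \<open>t \<in> {a..b}\<close> \<open>a \<le> b\<close> by (intro mult_nonpos_nonneg) auto
  ultimately show ?thesis by linarith
qed

text \<open>The form in which all invariant regions below are obtained: at the first time at which some member
  vanishes it has been decreasing to 0, so its derivative there cannot be positive.  Only contact
  points, where in addition all other members are nonnegative, have to be examined.\<close>

lemma family_stays_positive:
  fixes f :: "'i::finite \<Rightarrow> real \<Rightarrow> real"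
  assumes der: "\<And>i t. s \<le> t \<Longrightarrow> (f i has_real_derivative f' i t) (at t within {s..})"
    and init: "\<And>i. 0 < f i s"
    and touch: "\<And>i t. s \<le> t \<Longrightarrow> f i t = 0 \<Longrightarrow> (\<And>j. 0 \<le> f j t) \<Longrightarrow> 0 < f' i t"
    and "s \<le> t"
  shows "0 < f i t"
proof (rule ccontr)
  assume neg: "\<not> 0 < f i t"
  have cont: "continuous_on {s..} (f j)" for j
    using der by (auto intro!: DERIV_continuous_on)
  define B where "B = (\<Union>j. {u \<in> {s..t}. f j u \<le> 0})"
  have "closed {u \<in> {s..t}. f j u \<le> 0}" for j
    by (intro continuous_on_closed_Collect_le continuous_intros continuous_on_subset[OF cont]) auto
  then have "closed B" unfolding B_def by (intro closed_UN) auto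
  moreover have "B \<noteq> {}" "bdd_below B"
    using neg \<open>s \<le> t\<close> by (force simp: B_def not_less intro!: bdd_belowI[of _ s])+
  ultimately have "Inf B \<in> B" by (simp add: closed_contains_Inf)
  define T where "T = Inf B"
  obtain k where T: "s \<le> T" "T \<le> t" "f k T \<le> 0"
    using \<open>Inf B \<in> B\<close> by (auto simp: B_def T_def)
  have before: "0 < f j u" if "s \<le> u" "u < T" for j u
  proof (rule ccontr)
    assume "\<not> 0 < f j u"
    then have "u \<in> B" using that T by (auto simp: B_def not_less intro!: exI[of _ j])
    then show False using cInf_lower[OF _ \<open>bdd_below B\<close>] \<open>u < T\<close> by (fastforce simp: T_def)
  qed
  have "s < T" using T init[of k] by (cases "s = T") auto
  have nonneg: "0 \<le> f j T" for j
  proof (rule ccontr)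
    assume *: "\<not> 0 \<le> f j T"
    have "\<exists>u\<ge>s. u \<le> T \<and> f j u = 0"
      using * init[of j] T by (intro IVT2' continuous_on_subset[OF cont]) auto
    then show False using before * by (metis less_eq_real_def less_irrefl)
  qed
  then have "f k T = 0" using T(3) by (simp add: order_antisym)
  then have "0 < f' k T" using touch nonneg T(1) by blast
  then obtain d where d: "d > 0" "\<And>h. h > 0 \<Longrightarrow> T - h \<in> {s..} \<Longrightarrow> h < d \<Longrightarrow> f k (T - h) < f k T"
    using has_real_derivative_pos_inc_left[OF der[OF T(1)]] by blast
  define h where "h = min (d / 2) (T - s)"
  have h: "0 < h" "h < d" "s \<le> T - h" using d(1) \<open>s < T\<close> by (auto simp: h_def min_def)
  have "f k (T - h) < 0" using d(2)[of h] h \<open>f k T = 0\<close> by simp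
  moreover have "0 < f k (T - h)" using h by (intro before) auto
  ultimately show False by simp
qed

lemma norm_cis_diff_le: "cmod (cis a - cis b) \<le> \<bar>a - b\<bar>"
proof -
  have "cis a - cis b = cis b * (cis (a - b) - 1)" by (simp add: right_diff_distrib cis_mult)
  then have "cmod (cis a - cis b) = cmod (cis (a - b) - 1)" by (simp add: norm_mult)
  also have "\<dots> = 2 * \<bar>sin ((a - b) / 2)\<bar>"
    using dist_exp_i_1[of "a - b"] by (simp add: cis_conv_exp)
  also have "\<dots> \<le> \<bar>a - b\<bar>" using abs_sin_x_le_abs_x[of "(a - b) / 2"] by simp
  finally show ?thesis .
qed

section \<open>Global solutions of Lipschitz differential equations\<close>

text \<open>Exponentially weighted estimates gain the factor \<open>1 / k\<close>, which makes the Picard operator a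
  contraction on the whole half-line.\<close>

lemma norm_integral_le_exp:
  fixes g :: "real \<Rightarrow> 'a::banach"
  assumes "0 < k" "0 \<le> t" "continuous_on {0..t} g"
    and "\<And>s. 0 \<le> s \<Longrightarrow> s \<le> t \<Longrightarrow> norm (g s) \<le> M * exp (k * s)"
  shows "norm (integral {0..t} g) \<le> M / k * exp (k * t)"
proof -
  have hi: "((\<lambda>s. M * exp (k * s)) has_integral (M / k * exp (k * t) - M / k * exp (k * 0))) {0..t}"
    using assms(1,2) by (intro fundamental_theorem_of_calculus)
      (auto intro!: derivative_eq_intros simp flip: has_real_derivative_iff_has_vector_derivative)
  have "norm (integral {0..t} g) \<le> integral {0..t} (\<lambda>s. M * exp (k * s))"
    using assms hi by (intro integral_norm_bound_integral integrable_continuous_real)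
      (auto intro!: continuous_intros)
  also have "\<dots> = M / k * exp (k * t) - M / k" using integral_unique[OF hi] by simp
  also have "\<dots> \<le> M / k * exp (k * t)"
  proof -
    have "norm (g 0) \<le> M" using assms(4)[of 0] assms(2) by simp
    then have "0 \<le> M" by (rule order_trans[OF norm_ge_zero])
    then show ?thesis using assms(1) by simp
  qed
  finally show ?thesis .
qed

lemma has_vector_derivative_integral_from_0:
  fixes h :: "real \<Rightarrow> 'a::banach"
  assumes "continuous_on {0..} h" "0 \<le> t"
  shows "((\<lambda>u. integral {0..u} h) has_vector_derivative h t) (at t within {0..})"
proof -
  have "((\<lambda>u. integral {0..u} h) has_vector_derivative h t) (at t within {0..t + 1})"
    using assms by (intro integral_has_vector_derivative continuous_on_subset[OF assms(1)]) auto
  moreover have "at t within {0..t + 1} = at t within {0..}"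
    by (rule at_within_nhd[where S = "{..<t + 1}"]) auto
  ultimately show ?thesis by simp
qed

text \<open>Bielecki's proof: for the unknown \<open>exp (- k * t) *\<^sub>R u t\<close> with \<open>k = 2 * L\<close>, the Picard operator maps
  bounded continuous functions to such functions and contracts the supremum norm by the factor \<open>1 / 2\<close>,
  so a single application of the Banach fixed point theorem covers all times.\<close>

lemma lipschitz_ode_global_solution:
  fixes G :: "'a::banach \<Rightarrow> 'a"
  assumes lip: "\<And>u v. norm (G u - G v) \<le> L * norm (u - v)" and "0 < L"
  obtains u where "u 0 = u0"
    and "\<And>t. 0 \<le> t \<Longrightarrow> (u has_vector_derivative G (u t)) (at t within {0..})"
proof -
  define k where "k = 2 * L"
  have "0 < k" using \<open>0 < L\<close> by (simp add: k_def)
  have contG: "continuous_on UNIV G"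
    using lip \<open>0 < L\<close> by (intro lipschitz_on_continuous_on[of L] lipschitz_onI) (auto simp: dist_norm)
  define h where "h v s = G (exp (k * s) *\<^sub>R apply_bcontfun v s)" for v s
  define T where "T v t = exp (- k * max 0 t) *\<^sub>R (u0 + integral {0..max 0 t} (h v))" for v t
  have conth: "continuous_on S (h v)" for S v
    unfolding h_def by (rule continuous_on_compose2[OF contG]) (auto intro!: continuous_intros)
  have scale: "norm (exp (- k * t) *\<^sub>R x) \<le> M / k"
    if "norm x \<le> M / k * exp (k * t)" for t M and x :: 'a
    using that by (simp add: exp_minus field_simps)
  have T_cont: "T v \<in> bcontfun" for v
  proof (rule bcontfun_normI)
    have "continuous_on {0..} (\<lambda>u. integral {0..u} (h v))"
      using has_vector_derivative_integral_from_0[OF conth]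
      by (intro continuous_on_vector_derivative) auto
    then have "continuous_on UNIV (\<lambda>t. integral {0..max 0 t} (h v))"
      by (rule continuous_on_compose2) (auto intro!: continuous_intros)
    then show "continuous_on UNIV (T v)"
      unfolding T_def by (intro continuous_intros)
    define M where "M = norm (G 0) + L * norm v"
    fix t :: real
    define t' where "t' = max 0 t"
    have "norm (h v s) \<le> M * exp (k * s)" if "0 \<le> s" for s
    proof -
      have "norm (h v s) \<le> norm (G 0) + norm (h v s - G 0)"
        by (metis add.commute diff_add_cancel norm_triangle_ineq)
      also have "norm (h v s - G 0) \<le> L * (exp (k * s) * norm (apply_bcontfun v s))"
        using lip[of "exp (k * s) *\<^sub>R apply_bcontfun v s" 0] by (simp add: h_def)
      also have "\<dots> \<le> L * (exp (k * s) * norm v)"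
        using \<open>0 < L\<close> by (simp add: norm_bounded)
      also have "norm (G 0) \<le> norm (G 0) * exp (k * s)"
        using that \<open>0 < k\<close> by (simp add: mult_le_cancel_left1)
      finally show ?thesis by (simp add: M_def algebra_simps)
    qed
    then have "norm (exp (- k * t') *\<^sub>R integral {0..t'} (h v)) \<le> M / k"
      using \<open>0 < k\<close> by (intro scale norm_integral_le_exp conth) (auto simp: t'_def)
    moreover have "norm (exp (- k * t') *\<^sub>R u0) \<le> norm u0"
      using \<open>0 < k\<close> by (auto simp: t'_def mult_left_le_one_le)
    ultimately show "norm (T v t) \<le> norm u0 + M / k"
      unfolding T_def t'_def[symmetric] scaleR_add_right by (intro norm_triangle_mono)
  qed
  have "dist (Bcontfun (T v)) (Bcontfun (T w)) \<le> 1 / 2 * dist v w" for v w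
  proof (rule dist_bound)
    fix t :: real
    define t' where "t' = max 0 t"
    have "norm (h v s - h w s) \<le> L * dist v w * exp (k * s)" for s
    proof -
      have "norm (h v s - h w s) \<le> L * (exp (k * s) * dist (apply_bcontfun v s) (apply_bcontfun w s))"
        using lip[of "exp (k * s) *\<^sub>R apply_bcontfun v s" "exp (k * s) *\<^sub>R apply_bcontfun w s"]
        by (simp add: h_def dist_norm flip: scaleR_diff_right)
      also have "\<dots> \<le> L * (exp (k * s) * dist v w)"
        using \<open>0 < L\<close> by (simp add: dist_bounded)
      finally show ?thesis by (simp add: mult_ac)
    qed
    then have "norm (exp (- k * t') *\<^sub>R integral {0..t'} (\<lambda>s. h v s - h w s)) \<le> L * dist v w / k"
      using \<open>0 < k\<close>
      by (intro scale norm_integral_le_exp continuous_on_diff conth) (auto simp: t'_def)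
    also have "integral {0..t'} (\<lambda>s. h v s - h w s) = integral {0..t'} (h v) - integral {0..t'} (h w)"
      by (intro Henstock_Kurzweil_Integration.integral_diff integrable_continuous_real conth)
    finally show "dist (apply_bcontfun (Bcontfun (T v)) t) (apply_bcontfun (Bcontfun (T w)) t)
        \<le> 1 / 2 * dist v w"
      using \<open>0 < L\<close> by (simp add: Bcontfun_inverse T_cont T_def t'_def[symmetric] dist_norm k_def
          flip: scaleR_diff_right)
  qed
  then obtain v where v: "Bcontfun (T v) = v"
    using banach_fix_type[of "1 / 2" "\<lambda>v. Bcontfun (T v)"] by auto
  define u where "u t = u0 + integral {0..t} (h v)" for t
  show thesis
  proof
    show "u 0 = u0" by (simp add: u_def)
  next
    fix t :: real assume "0 \<le> t"
    have "apply_bcontfun v t = T v t" using v T_cont Bcontfun_inverse by metis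
    then have "exp (k * t) *\<^sub>R apply_bcontfun v t = u t"
      using \<open>0 \<le> t\<close> by (simp add: T_def u_def exp_minus)
    then have "h v t = G (u t)" by (simp add: h_def)
    then show "(u has_vector_derivative G (u t)) (at t within {0..})"
      unfolding u_def using has_vector_derivative_integral_from_0[OF conth \<open>0 \<le> t\<close>, of v]
      by (auto intro!: derivative_eq_intros)
  qed
qed

section \<open>Exponential convergence\<close>

text \<open>Most rates below are not computed but inherited in this way from a quantity that is already known
  to decay.\<close>

lemma exp_converges_bound:
  assumes "exp_converges g 0" and "\<And>t. 0 \<le> t \<Longrightarrow> \<bar>f t - q\<bar> \<le> K * \<bar>g t\<bar>"
  shows "exp_converges f q"
proof -
  obtain C \<gamma> where C: "0 < C" "0 < \<gamma>" "\<And>t. 0 \<le> t \<Longrightarrow> \<bar>g t\<bar> \<le> C * exp (- \<gamma> * t)"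
    using assms(1) by (auto simp: exp_converges_def)
  have "\<bar>f t - q\<bar> \<le> ((\<bar>K\<bar> + 1) * C) * exp (- \<gamma> * t)" if "0 \<le> t" for t
  proof -
    have "\<bar>f t - q\<bar> \<le> (\<bar>K\<bar> + 1) * \<bar>g t\<bar>"
      using assms(2)[OF that] mult_right_mono[of K "\<bar>K\<bar> + 1" "\<bar>g t\<bar>"] by linarith
    also have "\<dots> \<le> (\<bar>K\<bar> + 1) * (C * exp (- \<gamma> * t))"
      using C(3)[OF that] by (intro mult_left_mono) auto
    finally show ?thesis by (simp add: mult.assoc)
  qed
  moreover have "0 < (\<bar>K\<bar> + 1) * C" using C(1) by simp
  ultimately show ?thesis using C(2) unfolding exp_converges_def by blast
qed

lemma exp_converges_add:
  assumes "exp_converges f 0" "exp_converges g 0"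
  shows "exp_converges (\<lambda>t. f t + g t) 0"
proof -
  obtain C \<gamma> where C: "0 < C" "0 < \<gamma>" "\<And>t. 0 \<le> t \<Longrightarrow> \<bar>f t\<bar> \<le> C * exp (- \<gamma> * t)"
    using assms(1) by (auto simp: exp_converges_def)
  obtain D \<delta> where D: "0 < D" "0 < \<delta>" "\<And>t. 0 \<le> t \<Longrightarrow> \<bar>g t\<bar> \<le> D * exp (- \<delta> * t)"
    using assms(2) by (auto simp: exp_converges_def)
  have "\<bar>f t + g t\<bar> \<le> (C + D) * exp (- min \<gamma> \<delta> * t)" if "0 \<le> t" for t
  proof -
    have "C * exp (- \<gamma> * t) \<le> C * exp (- min \<gamma> \<delta> * t)"
      "D * exp (- \<delta> * t) \<le> D * exp (- min \<gamma> \<delta> * t)"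
      using C D that by (auto intro!: mult_right_mono)
    then show ?thesis using C(3)[OF that] D(3)[OF that] abs_triangle_ineq[of "f t" "g t"]
      unfolding distrib_right by linarith
  qed
  moreover have "0 < C + D" "0 < min \<gamma> \<delta>" using C D by auto
  ultimately show ?thesis unfolding exp_converges_def by (metis diff_0_right)
qed

lemma exp_converges_zero: "exp_converges (\<lambda>t. 0) 0"
  unfolding exp_converges_def by (rule exI[of _ 1], simp, rule exI[of _ 1], simp)

lemma exp_converges_sum:
  assumes "finite S" and "\<And>i. i \<in> S \<Longrightarrow> exp_converges (f i) 0"
  shows "exp_converges (\<lambda>t. \<Sum>i\<in>S. f i t) 0"
  using assms by (induction S rule: finite_induct) (auto intro: exp_converges_add exp_converges_zero)

lemma exp_converges_mult_left:
  assumes "exp_converges f 0" shows "exp_converges (\<lambda>t. K * f t) 0"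
  by (rule exp_converges_bound[OF assms, of _ _ "\<bar>K\<bar>"]) (simp add: abs_mult)

lemma exp_converges_abs_iff: "exp_converges (\<lambda>t. \<bar>f t\<bar>) 0 \<longleftrightarrow> exp_converges f 0"
  by (simp add: exp_converges_def)

lemma exp_converges_diff:
  assumes "exp_converges f q" "exp_converges g q"
  shows "exp_converges (\<lambda>t. f t - g t) 0"
proof -
  have "exp_converges (\<lambda>t. \<bar>f t - q\<bar> + \<bar>g t - q\<bar>) 0"
    using assms by (intro exp_converges_add) (auto simp: exp_converges_def)
  then show ?thesis by (rule exp_converges_bound[where K = 1]) auto
qed

lemma exp_converges_imp_tendsto:
  assumes "exp_converges f q"
  shows "(f \<longlongrightarrow> q) at_top"
proof -
  obtain C \<gamma> where C: "0 < C" "0 < \<gamma>" "\<And>t. 0 \<le> t \<Longrightarrow> \<bar>f t - q\<bar> \<le> C * exp (- \<gamma> * t)"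
    using assms by (auto simp: exp_converges_def)
  have "filterlim (\<lambda>t. - \<gamma> * t) at_bot at_top"
    using C(2) by (intro filterlim_tendsto_neg_mult_at_bot[OF tendsto_const] filterlim_ident) auto
  then have lim: "((\<lambda>t. C * exp (- \<gamma> * t)) \<longlongrightarrow> C * 0) at_top"
    by (intro tendsto_mult tendsto_const filterlim_compose[OF exp_at_bot])
  have "((\<lambda>t. f t - q) \<longlongrightarrow> 0) at_top"
  proof (rule Lim_null_comparison[rotated])
    show "\<forall>\<^sub>F t in at_top. norm (f t - q) \<le> C * exp (- \<gamma> * t)"
      using C(3) by (intro eventually_mono[OF eventually_ge_at_top[of 0]]) auto
  qed (use lim in simp)
  then show ?thesis by (simp add: LIM_zero_iff)
qed

text \<open>Contraction over every time step of length \<open>d\<close> gives geometric decay along multiples of \<open>d\<close>;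
  monotonicity fills in the times between.\<close>

lemma exp_converges_of_contraction:
  assumes nonneg: "\<And>t. 0 \<le> t \<Longrightarrow> 0 \<le> D t"
    and anti: "\<And>s t. 0 \<le> s \<Longrightarrow> s \<le> t \<Longrightarrow> D t \<le> D s"
    and contr: "\<And>t. 0 \<le> t \<Longrightarrow> D (t + d) \<le> q * D t"
    and "0 < d" "0 < q" "q < 1"
  shows "exp_converges D 0"
proof -
  have pow: "D (real n * d) \<le> q ^ n * D 0" for n
  proof (induction n)
    case (Suc n)
    have "D (real (Suc n) * d) = D (real n * d + d)" by (simp add: algebra_simps)
    also have "\<dots> \<le> q * D (real n * d)" using \<open>0 < d\<close> by (intro contr) auto
    also have "\<dots> \<le> q * (q ^ n * D 0)" using Suc \<open>0 < q\<close> by simp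
    finally show ?case by simp
  qed simp
  have "\<bar>D t - 0\<bar> \<le> (D 0 + 1) / q * exp (- (- ln q / d) * t)" if "0 \<le> t" for t
  proof -
    define n where "n = nat \<lfloor>t / d\<rfloor>"
    have n: "real n \<le> t / d" "t / d \<le> real (Suc n)"
      using that \<open>0 < d\<close> by (auto simp: n_def) linarith
    have "D t \<le> D (real n * d)" using n(1) \<open>0 < d\<close> by (intro anti) (auto simp: field_simps)
    also have "\<dots> \<le> q ^ n * D 0" by (rule pow)
    also have "\<dots> \<le> q ^ n * (D 0 + 1)" using \<open>0 < q\<close> by simp
    also have "q ^ n = q powr real (Suc n) / q"
      using \<open>0 < q\<close> by (simp add: powr_realpow del: of_nat_Suc)
    also have "q powr real (Suc n) \<le> q powr (t / d)"
      using n(2) \<open>0 < q\<close> \<open>q < 1\<close> by (intro powr_mono') auto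
    also have "q powr (t / d) = exp (- (- ln q / d) * t)"
      using \<open>0 < q\<close> by (simp add: powr_def mult.commute)
    finally show ?thesis
      using nonneg[OF that] nonneg[of 0] \<open>0 < q\<close> by (simp add: divide_right_mono mult_right_mono mult.commute)
  qed
  moreover have "0 < (D 0 + 1) / q" "0 < - ln q / d"
    using nonneg[of 0] \<open>0 < q\<close> \<open>q < 1\<close> \<open>0 < d\<close> by (auto simp: divide_neg_pos ln_less_zero)
  ultimately show ?thesis unfolding exp_converges_def by blast
qed

section \<open>Consensus on a connected graph\<close>

text \<open>The maximum principle: a largest component is only pulled downwards.\<close>

lemma consensus_upper_bound:
  fixes \<rho> :: "'i::finite \<Rightarrow> real \<Rightarrow> real"
  assumes der: "\<And>l t. 0 \<le> t \<Longrightarrow>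
      (\<rho> l has_real_derivative (\<Sum>k\<in>UNIV. W l k t * (\<rho> k t - \<rho> l t))) (at t within {0..})"
    and nonneg: "\<And>l k t. 0 \<le> t \<Longrightarrow> 0 \<le> W l k t"
    and "0 \<le> s" "s \<le> t" and M: "\<And>k. \<rho> k s \<le> M"
  shows "\<rho> l t \<le> M"
proof (rule field_le_epsilon)
  fix e :: real assume "0 < e"
  define \<epsilon> where "\<epsilon> = e / (1 + (t - s))"
  have "0 < \<epsilon>" using \<open>0 < e\<close> \<open>s \<le> t\<close> by (simp add: \<epsilon>_def)
  \<comment> \<open>A barrier of positive slope turns the weak inequality at a contact point into a strict one.\<close>
  have "0 < M + \<epsilon> * (1 + (t - s)) - \<rho> l t"
  proof (rule family_stays_positive[where s = s and f = "\<lambda>l t. M + \<epsilon> * (1 + (t - s)) - \<rho> l t"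
        and f' = "\<lambda>l t. \<epsilon> - (\<Sum>k\<in>UNIV. W l k t * (\<rho> k t - \<rho> l t))"])
    fix i t assume "s \<le> t"
    have "(\<rho> i has_real_derivative (\<Sum>k\<in>UNIV. W i k t * (\<rho> k t - \<rho> i t))) (at t within {s..})"
      using der[of t i] \<open>0 \<le> s\<close> \<open>s \<le> t\<close> by (auto intro: DERIV_subset)
    then show "((\<lambda>t. M + \<epsilon> * (1 + (t - s)) - \<rho> i t) has_real_derivative
        \<epsilon> - (\<Sum>k\<in>UNIV. W i k t * (\<rho> k t - \<rho> i t))) (at t within {s..})"
      by (auto intro!: derivative_eq_intros)
  next
    show "0 < M + \<epsilon> * (1 + (s - s)) - \<rho> i s" for i using M[of i] \<open>0 < \<epsilon>\<close> by simp
  next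
    fix i t assume *: "s \<le> t" "M + \<epsilon> * (1 + (t - s)) - \<rho> i t = 0"
      "\<And>j. 0 \<le> M + \<epsilon> * (1 + (t - s)) - \<rho> j t"
    have "(\<Sum>k\<in>UNIV. W i k t * (\<rho> k t - \<rho> i t)) \<le> 0"
    proof (intro sum_nonpos mult_nonneg_nonpos nonneg)
      show "\<rho> k t - \<rho> i t \<le> 0" for k using *(2) *(3)[of k] by linarith
    qed (use * \<open>0 \<le> s\<close> in auto)
    then show "0 < \<epsilon> - (\<Sum>k\<in>UNIV. W i k t * (\<rho> k t - \<rho> i t))" using \<open>0 < \<epsilon>\<close> by simp
  qed fact
  moreover have "\<epsilon> * (1 + (t - s)) = e" using \<open>s \<le> t\<close> by (simp add: \<epsilon>_def)
  ultimately show "\<rho> l t \<le> M + e" by simp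
qed

lemma consensus_lower_bound:
  fixes \<rho> :: "'i::finite \<Rightarrow> real \<Rightarrow> real"
  assumes der: "\<And>l t. 0 \<le> t \<Longrightarrow>
      (\<rho> l has_real_derivative (\<Sum>k\<in>UNIV. W l k t * (\<rho> k t - \<rho> l t))) (at t within {0..})"
    and nonneg: "\<And>l k t. 0 \<le> t \<Longrightarrow> 0 \<le> W l k t"
    and "0 \<le> s" "s \<le> t" and M: "\<And>k. M \<le> \<rho> k s"
  shows "M \<le> \<rho> l t"
proof -
  have "- \<rho> l t \<le> - M"
  proof (rule consensus_upper_bound[where \<rho> = "\<lambda>l t. - \<rho> l t" and W = W, OF _ nonneg])
    show "((\<lambda>t. - \<rho> l t) has_real_derivative (\<Sum>k\<in>UNIV. W l k t * (- \<rho> k t - - \<rho> l t)))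
        (at t within {0..})" if "0 \<le> t" for l t
      using DERIV_minus[OF der[OF that, of l]]
      by (simp add: sum_negf[symmetric] algebra_simps del: sum_negf)
  qed (use assms in auto)
  then show ?thesis by simp
qed

text \<open>The loops of \<open>Id\<close> allow paths to wait, so that one length serves all pairs of nodes.\<close>

lemma uniform_path_length:
  fixes E :: "('i::finite \<times> 'i) set"
  assumes "\<And>l k. (l, k) \<in> E\<^sup>*"
  obtains d where "0 < d" and "\<And>l k. (l, k) \<in> (E \<union> Id) ^^ d"
proof -
  have "\<exists>n. (l, k) \<in> E ^^ n" for l k using assms rtrancl_power by fast
  then obtain n where n: "\<And>l k. (l, k) \<in> E ^^ n l k" by metis
  define d where "d = Suc (\<Sum>l\<in>UNIV. \<Sum>k\<in>UNIV. n l k)"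
  have mono: "R ^^ m \<subseteq> (R \<union> Id) ^^ (m + j)" for R :: "('i \<times> 'i) set" and m j
  proof (induction j)
    case 0
    show ?case by (induction m) auto
  qed auto
  have "n l k \<le> d" for l k
  proof -
    have "n l k \<le> (\<Sum>k\<in>UNIV. n l k)" by (intro member_le_sum) auto
    also have "\<dots> \<le> (\<Sum>l\<in>UNIV. \<Sum>k\<in>UNIV. n l k)"
      by (rule member_le_sum[where f = "\<lambda>l. \<Sum>k\<in>UNIV. n l k"]) auto
    finally show ?thesis by (simp add: d_def)
  qed
  then have "(l, k) \<in> (E \<union> Id) ^^ d" for l k
    using mono[where m = "n l k" and j = "d - n l k"] n[of l k] by auto
  then show thesis using that[of d] by (simp add: d_def)
qed

text \<open>Height above the minimum spreads along edges: in each unit of time a node receives at least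
  the fraction \<open>wmin\<close> of the height of every neighbour, and the outflow costs at most the factor
  \<open>exp (- wmax)\<close>.\<close>

lemma consensus_delayed_lower_bound:
  fixes \<rho> :: "'i::finite \<Rightarrow> real \<Rightarrow> real"
  assumes der: "\<And>l t. 0 \<le> t \<Longrightarrow>
      (\<rho> l has_real_derivative (\<Sum>k\<in>UNIV. W l k t * (\<rho> k t - \<rho> l t))) (at t within {0..})"
    and nonneg: "\<And>l k t. 0 \<le> t \<Longrightarrow> 0 \<le> W l k t"
    and total: "\<And>l t. 0 \<le> t \<Longrightarrow> (\<Sum>k\<in>UNIV. W l k t) \<le> wmax"
    and edge: "\<And>l k t. 0 \<le> t \<Longrightarrow> (l, k) \<in> E \<Longrightarrow> wmin \<le> W l k t"
    and wmin: "0 < wmin" "wmin \<le> 1" and "0 \<le> s" and m: "\<And>k. m \<le> \<rho> k s"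
    and path: "(l, k) \<in> (E \<union> Id) ^^ d"
  shows "wmin ^ d * exp (- wmax * real d) * (\<rho> k s - m) \<le> \<rho> l (s + real d) - m"
proof -
  \<comment> \<open>The factor \<open>exp (wmax * (t - s))\<close> absorbs the outflow, so that what remains only grows.\<close>
  define v where "v l t = exp (wmax * (t - s)) * (\<rho> l t - m)" for l t
  define v' where "v' l t = exp (wmax * (t - s)) *
      (wmax * (\<rho> l t - m) + (\<Sum>k\<in>UNIV. W l k t * (\<rho> k t - \<rho> l t)))" for l t
  have above: "m \<le> \<rho> l t" if "s \<le> t" for l t
    using consensus_lower_bound[OF der nonneg \<open>0 \<le> s\<close> that m] .
  have v_nonneg: "0 \<le> v l t" if "s \<le> t" for l t using above[OF that] by (simp add: v_def)
  have v_der: "(v l has_real_derivative v' l t) (at t within {a..b})" if "s \<le> a" "a \<le> t" for l t a b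
  proof -
    have "(\<rho> l has_real_derivative (\<Sum>k\<in>UNIV. W l k t * (\<rho> k t - \<rho> l t))) (at t within {a..b})"
      using der[of t l] \<open>0 \<le> s\<close> that by (auto intro: DERIV_subset)
    then show ?thesis unfolding v_def v'_def
      by (auto intro!: derivative_eq_intros simp: algebra_simps)
  qed
  have inflow: "(\<Sum>k\<in>UNIV. W l k t * v k t) \<le> v' l t" if "s \<le> t" for l t
  proof -
    have "(\<Sum>k\<in>UNIV. W l k t) * (\<rho> l t - m) \<le> wmax * (\<rho> l t - m)"
      using total[of t l] above[OF that] \<open>0 \<le> s\<close> that by (intro mult_right_mono) auto
    then have "(\<Sum>k\<in>UNIV. W l k t * (\<rho> k t - m)) \<le>
        wmax * (\<rho> l t - m) + (\<Sum>k\<in>UNIV. W l k t * (\<rho> k t - \<rho> l t))"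
      by (simp add: algebra_simps sum.distrib sum_subtractf sum_distrib_left sum_distrib_right)
    then have "exp (wmax * (t - s)) * (\<Sum>k\<in>UNIV. W l k t * (\<rho> k t - m)) \<le> v' l t"
      unfolding v'_def by simp
    then show ?thesis by (simp add: v_def sum_distrib_left mult_ac)
  qed
  have v_mono: "v l a \<le> v l b" if "s \<le> a" "a \<le> b" for l a b
  proof -
    have "- v l b \<le> - v l a"
    proof (rule nonincreasing_of_deriv_nonpos[OF \<open>a \<le> b\<close> DERIV_minus[OF v_der]])
      fix t assume "a \<le> t"
      then have "0 \<le> (\<Sum>k\<in>UNIV. W l k t * v k t)"
        using nonneg v_nonneg \<open>0 \<le> s\<close> \<open>s \<le> a\<close> by (intro sum_nonneg mult_nonneg_nonneg) auto
      then show "- v' l t \<le> 0" using inflow[of t l] \<open>a \<le> t\<close> \<open>s \<le> a\<close> by simp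
    qed (use that in auto)
    then show ?thesis by simp
  qed
  have step: "wmin * v k t \<le> v l (t + 1)" if "(l, k) \<in> E \<union> Id" "s \<le> t" for l k t
  proof (cases "l = k")
    case True
    have "wmin * v l t \<le> v l t" using wmin v_nonneg[OF \<open>s \<le> t\<close>] by (simp add: mult_left_le_one_le)
    also have "\<dots> \<le> v l (t + 1)" using \<open>s \<le> t\<close> by (intro v_mono) auto
    finally show ?thesis using True by simp
  next
    case False
    then have "(l, k) \<in> E" using that by auto
    have "wmin * v k t * (t + 1) - v l (t + 1) \<le> wmin * v k t * t - v l t"
    proof (rule nonincreasing_of_deriv_nonpos[where f = "\<lambda>r. wmin * v k t * r - v l r"
          and f' = "\<lambda>r. wmin * v k t - v' l r"])
      fix r assume r: "t \<le> r" "r \<le> t + 1"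
      show "((\<lambda>r. wmin * v k t * r - v l r) has_real_derivative wmin * v k t - v' l r)
          (at r within {t..t + 1})"
        using v_der[of t r l "t + 1"] r \<open>s \<le> t\<close> by (auto intro!: derivative_eq_intros)
      have "wmin * v k t \<le> W l k r * v k r"
        using edge[of r l k] \<open>(l, k) \<in> E\<close> r \<open>s \<le> t\<close> \<open>0 \<le> s\<close> wmin v_nonneg v_mono
        by (intro mult_mono) auto
      also have "\<dots> \<le> (\<Sum>k\<in>UNIV. W l k r * v k r)"
        using nonneg v_nonneg r \<open>s \<le> t\<close> \<open>0 \<le> s\<close>
        by (intro member_le_sum mult_nonneg_nonneg) auto
      also have "\<dots> \<le> v' l r" using inflow r \<open>s \<le> t\<close> by simp
      finally show "wmin * v k t - v' l r \<le> 0" by simp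
    qed simp
    then show ?thesis using v_nonneg[OF \<open>s \<le> t\<close>, of l] by (simp add: algebra_simps)
  qed
  have "wmin ^ d * v k s \<le> v l (s + real d)" using path
  proof (induction d arbitrary: l)
    case 0
    then show ?case by simp
  next
    case (Suc d)
    then obtain j where j: "(l, j) \<in> E \<union> Id" "(j, k) \<in> (E \<union> Id) ^^ d"
      by (meson relpow_Suc_E2 relpow_Suc_D2)
    have "wmin ^ Suc d * v k s \<le> wmin * v j (s + real d)"
      using Suc.IH[OF j(2)] wmin by (simp add: mult.assoc)
    also have "\<dots> \<le> v l (s + real d + 1)" using j(1) by (intro step) auto
    finally show ?case by (simp add: algebra_simps)
  qed
  then have "wmin ^ d * (\<rho> k s - m) \<le> exp (wmax * real d) * (\<rho> l (s + real d) - m)"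
    by (simp add: v_def)
  then show ?thesis by (simp add: exp_minus field_simps)
qed

text \<open>After the time \<open>d\<close> of \<open>uniform_path_length\<close> the height of the largest component has reached
  every node, so the minimum has risen by a fixed fraction of the spread while the maximum has not
  risen.\<close>

lemma consensus_exponential:
  fixes \<rho> :: "'i::finite \<Rightarrow> real \<Rightarrow> real"
  assumes der: "\<And>l t. 0 \<le> t \<Longrightarrow>
      (\<rho> l has_real_derivative (\<Sum>k\<in>UNIV. W l k t * (\<rho> k t - \<rho> l t))) (at t within {0..})"
    and nonneg: "\<And>l k t. 0 \<le> t \<Longrightarrow> 0 \<le> W l k t"
    and total: "\<And>l t. 0 \<le> t \<Longrightarrow> (\<Sum>k\<in>UNIV. W l k t) \<le> wmax"
    and edge: "\<And>l k t. 0 \<le> t \<Longrightarrow> (l, k) \<in> E \<Longrightarrow> wmin \<le> W l k t" and "0 < wmin"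
    and connected: "\<And>l k. (l, k) \<in> E\<^sup>*"
  obtains r where "\<And>l. exp_converges (\<rho> l) r"
proof -
  obtain d where "0 < d" and path: "\<And>l k. (l, k) \<in> (E \<union> Id) ^^ d"
    using uniform_path_length[OF connected] by blast
  define M m where "M t = Max (range (\<lambda>l. \<rho> l t))" and "m t = Min (range (\<lambda>l. \<rho> l t))" for t
  have le_M: "\<rho> l t \<le> M t" and m_le: "m t \<le> \<rho> l t" for l t
    by (auto simp: M_def m_def)
  have M_le: "M t \<le> b \<longleftrightarrow> (\<forall>l. \<rho> l t \<le> b)" and le_m: "b \<le> m t \<longleftrightarrow> (\<forall>l. b \<le> \<rho> l t)" for t b
    by (auto simp: M_def m_def)
  have M_anti: "M t \<le> M s" and m_mono: "m s \<le> m t" if "0 \<le> s" "s \<le> t" for s t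
    using consensus_upper_bound[OF der nonneg that le_M] consensus_lower_bound[OF der nonneg that m_le]
    by (auto simp: M_le le_m)
  have m_le_M: "m s \<le> M t" if "0 \<le> s" "0 \<le> t" for s t
  proof -
    have "m s \<le> m (max s t)" using that by (intro m_mono) auto
    also have "\<dots> \<le> M (max s t)" using m_le le_M order_trans by blast
    also have "\<dots> \<le> M t" using that by (intro M_anti) auto
    finally show ?thesis .
  qed
  have "0 \<le> (\<Sum>k\<in>UNIV. W undefined k 0)" by (intro sum_nonneg nonneg) simp
  then have "0 \<le> wmax" using total[of 0 undefined] by simp
  \<comment> \<open>The contraction factor is \<open>1 - \<delta> / 2\<close> instead of \<open>1 - \<delta>\<close> to keep it positive when \<open>\<delta> = 1\<close>.\<close>
  define \<delta> where "\<delta> = min wmin 1 ^ d * exp (- wmax * real d)"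
  have "0 < \<delta>" using \<open>0 < wmin\<close> by (simp add: \<delta>_def)
  have "\<delta> \<le> 1 * 1"
    unfolding \<delta>_def using \<open>0 < wmin\<close> \<open>0 \<le> wmax\<close> by (intro mult_mono power_le_one) auto
  have "exp_converges (\<lambda>t. M t - m t) 0"
  proof (rule exp_converges_of_contraction[where d = "real d" and q = "1 - \<delta> / 2"])
    fix s :: real assume "0 \<le> s"
    have "M s \<in> range (\<lambda>l. \<rho> l s)" unfolding M_def by (intro Max_in) auto
    then obtain k where k: "\<rho> k s = M s" by auto
    have "\<delta> * (M s - m s) \<le> \<rho> l (s + real d) - m s" for l
      unfolding \<delta>_def k[symmetric]
      by (rule consensus_delayed_lower_bound[OF der nonneg total _ _ _ \<open>0 \<le> s\<close> m_le path])
         (use edge \<open>0 < wmin\<close> in \<open>auto simp: min.coboundedI1\<close>)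
    then have "m s + \<delta> * (M s - m s) \<le> m (s + real d)"
      by (auto simp: le_m add.commute le_diff_eq)
    moreover have "M (s + real d) \<le> M s" using \<open>0 \<le> s\<close> by (intro M_anti) auto
    moreover have "0 \<le> \<delta> * (M s - m s)"
      using \<open>0 < \<delta>\<close> m_le_M[OF \<open>0 \<le> s\<close> \<open>0 \<le> s\<close>] by simp
    ultimately show "M (s + real d) - m (s + real d) \<le> (1 - \<delta> / 2) * (M s - m s)"
      by (simp add: left_diff_distrib)
  next
    show "0 \<le> M t - m t" if "0 \<le> t" for t using m_le_M[OF that that] by simp
    show "M t - m t \<le> M s - m s" if "0 \<le> s" "s \<le> t" for s t
      using M_anti[OF that] m_mono[OF that] by simp
  qed (use \<open>0 < d\<close> \<open>0 < \<delta>\<close> \<open>\<delta> \<le> 1 * 1\<close> in auto)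
  moreover define r where "r = (SUP t\<in>{0..}. m t)"
  have "m t \<le> r" if "0 \<le> t" for t
    unfolding r_def using that m_le_M[of _ 0] by (intro cSUP_upper bdd_aboveI2[of _ _ "M 0"]) auto
  moreover have "r \<le> M t" if "0 \<le> t" for t
    unfolding r_def using that by (intro cSUP_least m_le_M) auto
  ultimately have "exp_converges (\<rho> l) r" for l
    by (elim exp_converges_bound[where K = 1]) (smt (verit) le_M m_le)
  then show thesis by (rule that)
qed

section \<open>The largest eigenvalue of the Laplacian\<close>

lemma symmetric_matrix_inner:
  fixes M :: "real ^ 'n ^ 'n"
  assumes "transpose M = M"
  shows "(M *v x) \<bullet> y = x \<bullet> (M *v y)"
  using dot_lmul_matrix[of x M y] assms by (simp flip: transpose_matrix_vector)

text \<open>Eigenvectors of different eigenvalues are orthogonal.  Finiteness is what gives the maximum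
  in \<^const>\<open>lambda_max\<close> its meaning.\<close>

lemma finite_real_eigenvalues:
  fixes M :: "real ^ 'n ^ 'n"
  assumes "transpose M = M"
  shows "finite (real_eigenvalues M)"
proof -
  obtain v where v: "\<And>a. a \<in> real_eigenvalues M \<Longrightarrow> v a \<noteq> 0 \<and> M *v v a = a *\<^sub>R v a"
    using bchoice[of "real_eigenvalues M" "\<lambda>a v. v \<noteq> 0 \<and> M *v v = a *\<^sub>R v"]
    by (auto simp: real_eigenvalues_def)
  have orth: "v a \<bullet> v b = 0" if "a \<in> real_eigenvalues M" "b \<in> real_eigenvalues M" "a \<noteq> b" for a b
  proof -
    have "(M *v v a) \<bullet> v b = v a \<bullet> (M *v v b)" by (rule symmetric_matrix_inner[OF assms])
    then have "(a - b) * (v a \<bullet> v b) = 0" using v that by (simp add: algebra_simps)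
    then show ?thesis using that by simp
  qed
  have inj: "inj_on v (real_eigenvalues M)"
    by (rule inj_onI) (metis orth v inner_eq_zero_iff)
  have "independent (v ` real_eigenvalues M)"
    using orth v by (intro pairwise_orthogonal_independent) (auto simp: pairwise_def orthogonal_def)
  then show ?thesis using inj finiteI_independent finite_imageD by blast
qed

text \<open>The first order condition for a maximizer of the quotient of \<open>(norm (M *v x))\<^sup>2\<close> by
  \<open>(norm x)\<^sup>2\<close>; in operator form it says that \<open>v\<close> is an eigenvector of \<open>transpose M ** M\<close>.\<close>

lemma norm_maximizer_inner:
  fixes M :: "real ^ 'n ^ 'n"
  assumes max: "\<And>x. (norm (M *v x))\<^sup>2 \<le> s * (norm x)\<^sup>2" and v: "(norm (M *v v))\<^sup>2 = s * (norm v)\<^sup>2"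
  shows "(M *v v) \<bullet> (M *v h) = s * (v \<bullet> h)"
proof -
  define b c where "b = s * (v \<bullet> h) - (M *v v) \<bullet> (M *v h)" and "c = s * (h \<bullet> h) - (M *v h) \<bullet> (M *v h)"
  have *: "0 \<le> 2 * t * b + t\<^sup>2 * c" for t
    using max[of "v + t *\<^sub>R h"] v
    unfolding power2_norm_eq_inner matrix_vector_right_distrib matrix_vector_mult_scaleR
    by (simp add: b_def c_def algebra_simps inner_commute power2_eq_square)
  have "b = 0"
  proof (rule ccontr)
    assume "b \<noteq> 0"
    \<comment> \<open>The point \<open>t = - b / k\<close> minimizes the parabola with \<open>k\<close> in place of \<open>c\<close>.\<close>
    define k where "k = \<bar>c\<bar> + 1"
    have "0 < k" "c < k" by (auto simp: k_def)
    have "0 \<le> 2 * (- b / k) * b + (- b / k)\<^sup>2 * c" by (rule *)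
    also have "\<dots> = - (b\<^sup>2 / k\<^sup>2) * (2 * k - c)"
      using \<open>0 < k\<close> by (simp add: power2_eq_square field_simps)
    also have "\<dots> < 0"
      using \<open>0 < k\<close> \<open>c < k\<close> \<open>b \<noteq> 0\<close> by (intro mult_neg_pos) (auto simp: zero_less_divide_iff)
    finally show False by simp
  qed
  then show ?thesis by (simp add: b_def)
qed

text \<open>The operator norm \<open>s\<close> is attained at a unit vector \<open>v\<close>, for which \<open>M\<^sup>2 v = s\<^sup>2 v\<close> by
  \<open>norm_maximizer_inner\<close>.  This produces an eigenvector of \<open>M\<close> itself for the eigenvalue \<open>s\<close>.\<close>

lemma norm_le_lambda_max:
  fixes M :: "real ^ 'n ^ 'n"
  assumes sym: "transpose M = M" and psd: "\<And>x. 0 \<le> x \<bullet> (M *v x)"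
  shows "norm (M *v x) \<le> lambda_max M * norm x"
proof -
  have "compact (sphere 0 1 :: (real ^ 'n) set)" "sphere 0 1 \<noteq> ({} :: (real ^ 'n) set)" by auto
  moreover have "continuous_on (sphere 0 1) (\<lambda>x. norm (M *v x))"
    by (intro continuous_intros matrix_vector_mult_linear_continuous_on)
  ultimately obtain v where v: "v \<in> sphere 0 1"
      "\<And>x. x \<in> sphere 0 1 \<Longrightarrow> norm (M *v x) \<le> norm (M *v v)"
    by (metis continuous_attains_sup)
  define s where "s = norm (M *v v)"
  have max: "norm (M *v x) \<le> s * norm x" for x
  proof (cases "x = 0")
    case False
    have "norm (M *v (x /\<^sub>R norm x)) \<le> s" unfolding s_def using False by (intro v(2)) auto
    also have "norm (M *v (x /\<^sub>R norm x)) = norm (M *v x) / norm x"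
      unfolding matrix_vector_mult_scaleR norm_scaleR by (simp add: divide_inverse)
    finally have "norm (M *v x) / norm x \<le> s" .
    then show ?thesis using False pos_divide_le_eq[of "norm x"] zero_less_norm_iff by blast
  qed simp
  have "norm v = 1" using v(1) by simp
  have "(M *v v) \<bullet> (M *v h) = s\<^sup>2 * (v \<bullet> h)" for h
  proof (rule norm_maximizer_inner)
    show "(norm (M *v x))\<^sup>2 \<le> s\<^sup>2 * (norm x)\<^sup>2" for x
      using power_mono[OF max[of x], of 2] by (simp add: power_mult_distrib)
  qed (simp add: s_def \<open>norm v = 1\<close>)
  then have "M *v (M *v v) = s\<^sup>2 *\<^sub>R v"
    using symmetric_matrix_inner[OF sym]
    by (subst vector_eq_ldot[symmetric]) (metis inner_commute inner_scaleR_right)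
  \<comment> \<open>Since \<open>(M - s) (M + s) v = 0\<close>, the vector \<open>u\<close> is an eigenvector for \<open>s\<close> unless it vanishes;
    in that case \<open>v\<close> is an eigenvector for \<open>- s\<close>, and semidefiniteness forces \<open>s = 0\<close>.\<close>
  define u where "u = M *v v + s *\<^sub>R v"
  have Mu: "M *v u = s *\<^sub>R u"
    by (simp add: u_def matrix_vector_right_distrib matrix_vector_mult_scaleR
        \<open>M *v (M *v v) = s\<^sup>2 *\<^sub>R v\<close> algebra_simps power2_eq_square)
  have "s \<in> real_eigenvalues M"
  proof (cases "u = 0")
    case True
    then have "M *v v = - (s *\<^sub>R v)" by (simp add: u_def eq_neg_iff_add_eq_0)
    then have "v \<bullet> (M *v v) = - s" using \<open>norm v = 1\<close> by (simp add: norm_eq_1)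
    then have "s = 0" using psd[of v] by (simp add: s_def order_antisym)
    then have "M *v v = s *\<^sub>R v" by (simp add: s_def)
    then show ?thesis using \<open>norm v = 1\<close> by (auto simp: real_eigenvalues_def intro!: exI[of _ v])
  next
    case False
    then show ?thesis using Mu by (auto simp: real_eigenvalues_def)
  qed
  then have "s \<le> lambda_max M"
    unfolding lambda_max_def by (intro Max_ge finite_real_eigenvalues[OF sym])
  then show ?thesis using max[of x] mult_right_mono[of s "lambda_max M" "norm x"] by simp
qed

lemma laplacian_component:
  "(laplacian A *v x) $ l = (\<Sum>k\<in>UNIV. A $ l $ k * (x $ l - x $ k))"
proof -
  have "(laplacian A *v x) $ l = (\<Sum>k\<in>UNIV. (if l = k then \<Sum>j\<in>UNIV. A $ l $ j else 0) * x $ k) -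
      (\<Sum>k\<in>UNIV. A $ l $ k * x $ k)"
    by (simp add: laplacian_def degree_matrix_def matrix_vector_mult_def algebra_simps sum_subtractf)
  also have "(\<Sum>k\<in>UNIV. (if l = k then \<Sum>j\<in>UNIV. A $ l $ j else 0) * x $ k) =
      (\<Sum>k\<in>UNIV. if l = k then (\<Sum>j\<in>UNIV. A $ l $ j) * x $ k else 0)"
    by (intro sum.cong) auto
  also have "\<dots> = (\<Sum>j\<in>UNIV. A $ l $ j) * x $ l" by simp
  finally show ?thesis by (simp add: right_diff_distrib sum_subtractf sum_distrib_right)
qed

text \<open>Exchanging the two summation indices turns the sum into
  \<open>- 1 / 2 * (\<Sum>l. \<Sum>k. A $ l $ k * (norm (u k - u l))\<^sup>2)\<close>.\<close>

lemma coupling_dissipates: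
  fixes u :: "'n::finite \<Rightarrow> 'a::real_inner" and A :: "real ^ 'n ^ 'n"
  assumes sym: "\<And>l k. A $ l $ k = A $ k $ l" and nonneg: "\<And>l k. 0 \<le> A $ l $ k"
  shows "(\<Sum>l\<in>UNIV. u l \<bullet> (\<Sum>k\<in>UNIV. A $ l $ k *\<^sub>R (u k - u l))) \<le> 0"
proof -
  define S where "S = (\<Sum>l\<in>UNIV. \<Sum>k\<in>UNIV. A $ l $ k * (u l \<bullet> (u k - u l)))"
  have "S = (\<Sum>l\<in>UNIV. \<Sum>k\<in>UNIV. A $ l $ k * (u k \<bullet> (u l - u k)))"
    unfolding S_def by (subst sum.swap) (simp add: sym)
  then have "2 * S = (\<Sum>l\<in>UNIV. \<Sum>k\<in>UNIV. - (A $ l $ k * ((u k - u l) \<bullet> (u k - u l))))"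
    unfolding mult_2 by (subst S_def)
      (simp add: sum.distrib[symmetric] algebra_simps inner_commute)
  also have "\<dots> \<le> 0" by (intro sum_nonpos) (simp add: nonneg)
  finally show ?thesis by (simp add: S_def inner_sum_right)
qed

lemma laplacian_psd:
  fixes A :: "real ^ 'n ^ 'n"
  assumes "\<And>l k. A $ l $ k = A $ k $ l" and "\<And>l k. 0 \<le> A $ l $ k"
  shows "0 \<le> x \<bullet> (laplacian A *v x)"
proof -
  have "x \<bullet> (laplacian A *v x) = - (\<Sum>l\<in>UNIV. x $ l \<bullet> (\<Sum>k\<in>UNIV. A $ l $ k *\<^sub>R (x $ k - x $ l)))"
    by (simp add: inner_vec_def laplacian_component sum_negf[symmetric] sum_distrib_left
        algebra_simps del: sum_negf)
  then show ?thesis using coupling_dissipates[OF assms, of "\<lambda>l. x $ l"] by simp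
qed

lemma laplacian_transpose:
  assumes "\<And>l k. A $ l $ k = A $ k $ l"
  shows "transpose (laplacian A) = laplacian A"
  using assms by (auto simp: transpose_def laplacian_def degree_matrix_def vec_eq_iff)

text \<open>The Laplacian is real, so its norm bound transfers to complex vectors through real and imaginary
  parts.\<close>

lemma complex_coupling_le:
  fixes A :: "real ^ 'n ^ 'n" and w :: "'n \<Rightarrow> complex"
  assumes "\<And>l k. A $ l $ k = A $ k $ l" and "\<And>l k. 0 \<le> A $ l $ k"
  shows "(\<Sum>l\<in>UNIV. (cmod (\<Sum>k\<in>UNIV. A $ l $ k *\<^sub>R (w k - w l)))\<^sup>2)
    \<le> (lambda_max (laplacian A))\<^sup>2 * (\<Sum>l\<in>UNIV. (cmod (w l))\<^sup>2)"
proof -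
  have real: "(\<Sum>l\<in>UNIV. (\<Sum>k\<in>UNIV. A $ l $ k * (x k - x l))\<^sup>2)
      \<le> (lambda_max (laplacian A))\<^sup>2 * (\<Sum>l\<in>UNIV. (x l)\<^sup>2)" for x :: "'n \<Rightarrow> real"
  proof -
    define v :: "real ^ 'n" where "v = (\<chi> l. x l)"
    have "(norm (laplacian A *v v))\<^sup>2 \<le> (lambda_max (laplacian A) * norm v)\<^sup>2"
      by (intro power_mono norm_le_lambda_max laplacian_transpose laplacian_psd assms) auto
    moreover have "(laplacian A *v v) $ l = - (\<Sum>k\<in>UNIV. A $ l $ k * (x k - x l))" for l
      by (simp add: laplacian_component v_def sum_negf[symmetric] algebra_simps del: sum_negf)
    ultimately show ?thesis
      by (simp add: power_mult_distrib norm_vec_def L2_set_def sum_nonneg v_def)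
  qed
  have "(\<Sum>l\<in>UNIV. (cmod (\<Sum>k\<in>UNIV. A $ l $ k *\<^sub>R (w k - w l)))\<^sup>2) =
     (\<Sum>l\<in>UNIV. (\<Sum>k\<in>UNIV. A $ l $ k * (Re (w k) - Re (w l)))\<^sup>2) +
     (\<Sum>l\<in>UNIV. (\<Sum>k\<in>UNIV. A $ l $ k * (Im (w k) - Im (w l)))\<^sup>2)"
    by (simp add: cmod_power2 sum.distrib)
  also have "\<dots> \<le> (lambda_max (laplacian A))\<^sup>2 * (\<Sum>l\<in>UNIV. (Re (w l))\<^sup>2) +
      (lambda_max (laplacian A))\<^sup>2 * (\<Sum>l\<in>UNIV. (Im (w l))\<^sup>2)"
    by (intro add_mono real)
  finally show ?thesis by (simp add: cmod_power2 sum.distrib distrib_left)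
qed

section \<open>Energy of the network in the rotating frame\<close>

text \<open>The right-hand side of the network equation in the rotating frame, with real scalars
  so that inner products in the plane can be used.\<close>

definition network_field :: "real ^ 'n ^ 'n \<Rightarrow> real \<Rightarrow> real \<Rightarrow> ('n \<Rightarrow> complex) \<Rightarrow> 'n \<Rightarrow> complex" where
  "network_field A \<mu> c w l =
     (\<mu> - (cmod (w l))\<^sup>2) *\<^sub>R w l + c *\<^sub>R (\<Sum>k\<in>UNIV. A $ l $ k *\<^sub>R (w k - w l))"

lemma has_real_derivative_norm_square:
  fixes w :: "real \<Rightarrow> 'a::real_inner"
  assumes "(w has_vector_derivative w') (at t within S)"
  shows "((\<lambda>t. (norm (w t))\<^sup>2) has_real_derivative 2 * (w t \<bullet> w')) (at t within S)"
proof -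
  have "((\<lambda>t. w t \<bullet> w t) has_vector_derivative (w t \<bullet> w' + w' \<bullet> w t)) (at t within S)"
    by (rule bounded_bilinear.has_vector_derivative[OF bounded_bilinear_inner assms assms])
  then show ?thesis
    by (simp add: has_real_derivative_iff_has_vector_derivative power2_norm_eq_inner inner_commute)
qed

lemma inner_network_field:
  "w l \<bullet> network_field A \<mu> c w l =
     (\<mu> - (cmod (w l))\<^sup>2) * (cmod (w l))\<^sup>2 + c * (\<Sum>k\<in>UNIV. A $ l $ k * (w l \<bullet> (w k - w l)))"
  by (simp add: network_field_def inner_add_right inner_sum_right power2_norm_eq_inner)

text \<open>The coupling drops out by \<open>coupling_dissipates\<close>, and the cubic term is estimated from below by the
  Cauchy-Schwarz inequality for the squared amplitudes.\<close>

lemma total_energy_growth: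
  fixes A :: "real ^ 'n ^ 'n"
  assumes "\<And>l k. A $ l $ k = A $ k $ l" and "\<And>l k. 0 \<le> A $ l $ k" and "0 \<le> c"
  defines "N \<equiv> real CARD('n)"
  shows "N * (\<Sum>l\<in>UNIV. w l \<bullet> network_field A \<mu> c w l)
    \<le> (\<Sum>l\<in>UNIV. (cmod (w l))\<^sup>2) * (N * \<mu> - (\<Sum>l\<in>UNIV. (cmod (w l))\<^sup>2))"
proof -
  define S where "S = (\<Sum>l\<in>UNIV. (cmod (w l))\<^sup>2)"
  have "(\<Sum>l\<in>UNIV. w l \<bullet> network_field A \<mu> c w l) = \<mu> * S - (\<Sum>l\<in>UNIV. ((cmod (w l))\<^sup>2)\<^sup>2) +
      c * (\<Sum>l\<in>UNIV. w l \<bullet> (\<Sum>k\<in>UNIV. A $ l $ k *\<^sub>R (w k - w l)))"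
    unfolding inner_network_field S_def
    by (simp add: sum.distrib sum_subtractf sum_distrib_left inner_sum_right left_diff_distrib
        power2_eq_square)
  also have "\<dots> \<le> \<mu> * S - (\<Sum>l\<in>UNIV. ((cmod (w l))\<^sup>2)\<^sup>2)"
    using coupling_dissipates[OF assms(1,2), of w] \<open>0 \<le> c\<close> by (simp add: mult_nonneg_nonpos)
  finally have "N * (\<Sum>l\<in>UNIV. w l \<bullet> network_field A \<mu> c w l)
      \<le> N * (\<mu> * S) - N * (\<Sum>l\<in>UNIV. ((cmod (w l))\<^sup>2)\<^sup>2)"
    unfolding right_diff_distrib[symmetric] by (intro mult_left_mono) (auto simp: N_def)
  moreover have "S\<^sup>2 \<le> N * (\<Sum>l\<in>UNIV. ((cmod (w l))\<^sup>2)\<^sup>2)"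
    using sum_squared_le_sum_of_squares[of "\<lambda>l. (cmod (w l))\<^sup>2" UNIV]
    by (simp add: S_def N_def mult.commute)
  ultimately show ?thesis unfolding S_def[symmetric] by (simp add: algebra_simps power2_eq_square)
qed

text \<open>The gap \<open>N * \<mu> - S\<close> satisfies a linear differential inequality by \<open>total_energy_growth\<close>, so it can
  close at most exponentially fast.  The equation is assumed only while the energy is
  below \<open>N * \<mu>\<close>, so that the lemma also applies to a field that is truncated outside this region.\<close>

lemma total_energy_bound:
  fixes A :: "real ^ 'n ^ 'n" and w :: "'n \<Rightarrow> real \<Rightarrow> complex"
  defines "N \<equiv> real CARD('n)" and "S \<equiv> \<lambda>t. \<Sum>l\<in>UNIV. (cmod (w l t))\<^sup>2"
  assumes sym: "\<And>l k. A $ l $ k = A $ k $ l" and nonneg: "\<And>l k. 0 \<le> A $ l $ k"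
    and "0 < \<mu>" "0 \<le> c"
    and der: "\<And>l t. 0 \<le> t \<Longrightarrow> (w l has_vector_derivative w' l t) (at t within {0..})"
    and field: "\<And>l t. 0 \<le> t \<Longrightarrow> S t < N * \<mu> \<Longrightarrow> w' l t = network_field A \<mu> c (\<lambda>k. w k t) l"
    and init: "S 0 < N * \<mu>" and "0 \<le> t"
  shows "S t < N * \<mu>"
proof -
  have "0 < N" by (simp add: N_def)
  \<comment> \<open>A barrier that closes faster than the rate \<open>2 * \<mu>\<close> at which the gap can close.\<close>
  define \<eta> where "\<eta> = (N * \<mu> - S 0) / 2"
  have "0 < \<eta>" using init by (simp add: \<eta>_def)
  define K where "K = 2 * \<mu> + 1"
  define f where "f (i :: unit) t = N * \<mu> - \<eta> * exp (- K * t) - S t" for i t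
  define f' where "f' (i :: unit) t = K * \<eta> * exp (- K * t) - 2 * (\<Sum>l\<in>UNIV. w l t \<bullet> w' l t)" for i t
  have "0 < f () t"
  proof (rule family_stays_positive[where f = f and f' = f' and s = 0])
    fix i and t :: real assume "0 \<le> t"
    have "(S has_real_derivative (\<Sum>l\<in>UNIV. 2 * (w l t \<bullet> w' l t))) (at t within {0..})"
      unfolding S_def using \<open>0 \<le> t\<close> by (intro DERIV_sum has_real_derivative_norm_square der)
    then show "(f i has_real_derivative f' i t) (at t within {0..})"
      unfolding f_def f'_def by (auto intro!: derivative_eq_intros simp: sum_distrib_left)
  next
    show "0 < f i 0" for i using \<open>0 < \<eta>\<close> by (simp add: f_def \<eta>_def field_simps)
  next
    fix i and t :: real assume "0 \<le> t" "f i t = 0"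
    then have gap: "N * \<mu> - S t = \<eta> * exp (- K * t)" by (simp add: f_def)
    then have "S t < N * \<mu>" using \<open>0 < \<eta>\<close> by (smt (verit) exp_gt_zero mult_pos_pos)
    then have "N * (\<Sum>l\<in>UNIV. w l t \<bullet> w' l t) \<le> S t * (N * \<mu> - S t)"
      using total_energy_growth[OF sym nonneg \<open>0 \<le> c\<close>, of "\<lambda>l. w l t" \<mu>] field[OF \<open>0 \<le> t\<close>]
      by (simp add: S_def N_def)
    also have "\<dots> \<le> (N * \<mu>) * (N * \<mu> - S t)"
      using \<open>S t < N * \<mu>\<close> by (intro mult_right_mono) auto
    finally have "(\<Sum>l\<in>UNIV. w l t \<bullet> w' l t) \<le> \<mu> * (N * \<mu> - S t)"
      using \<open>0 < N\<close> by (simp add: mult.assoc)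
    then have "- (\<mu> * (\<eta> * exp (- K * t))) \<le> - (\<Sum>l\<in>UNIV. w l t \<bullet> w' l t)" by (simp add: gap)
    moreover have "0 < \<eta> * exp (- K * t)" using \<open>0 < \<eta>\<close> by simp
    ultimately show "0 < f' i t" by (simp add: f'_def K_def algebra_simps)
  qed fact
  moreover have "0 < \<eta> * exp (- K * t)" using \<open>0 < \<eta>\<close> by simp
  ultimately show ?thesis by (simp add: f_def)
qed

text \<open>The network in the rotating frame.  The condition on the initial imaginary parts says that all
  initial phases lie in \<open>(0, pi)\<close>.\<close>

locale synchronizing_network =
  fixes A :: "real ^ 'n ^ 'n" and \<mu> c r0 :: real and w :: "'n \<Rightarrow> real \<Rightarrow> complex"
  assumes A_sym: "A $ l $ k = A $ k $ l" and A_01: "A $ l $ k \<in> {0, 1}"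
    and connected: "(l, k) \<in> {(i, j). A $ i $ j = 1}\<^sup>*"
    and mu_pos: "0 < \<mu>" and c_pos: "0 < c"
    and lambda_pos: "0 < lambda_max (laplacian A)"
    and r0_pos: "0 < r0"
    and r0_root: "\<mu> * r0 - r0 ^ 3 = c * sqrt (real CARD('n) * \<mu>) * lambda_max (laplacian A)"
    and ode: "0 \<le> t \<Longrightarrow>
      (w l has_vector_derivative network_field A \<mu> c (\<lambda>k. w k t) l) (at t within {0..})"
    and energy_init: "(\<Sum>l\<in>UNIV. (cmod (w l 0))\<^sup>2) < real CARD('n) * \<mu>"
    and amplitude_init: "r0 < cmod (w l 0)"
    and upper_half_plane_init: "0 < Im (w l 0)"
begin

abbreviation "field l t \<equiv> network_field A \<mu> c (\<lambda>k. w k t) l"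

text \<open>The energy bound confines every amplitude to the disc of radius \<open>R\<close>.\<close>

definition "R = sqrt (real CARD('n) * \<mu>)"

lemma A_nonneg: "0 \<le> A $ l $ k"
  using A_01[of l k] by auto

lemma A_le_1: "A $ l $ k \<le> 1"
  using A_01[of l k] by auto

lemma R_pos: "0 < R" and R_square: "R\<^sup>2 = real CARD('n) * \<mu>"
  using mu_pos by (auto simp: R_def)

lemma energy_bound: "0 \<le> t \<Longrightarrow> (\<Sum>l\<in>UNIV. (cmod (w l t))\<^sup>2) < R\<^sup>2"
  unfolding R_square
  by (rule total_energy_bound[OF A_sym A_nonneg mu_pos _ ode _ energy_init]) (use c_pos in auto)

lemma amplitude_upper: "0 \<le> t \<Longrightarrow> cmod (w l t) \<le> R"
proof -
  assume "0 \<le> t"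
  have "(cmod (w l t))\<^sup>2 \<le> (\<Sum>l\<in>UNIV. (cmod (w l t))\<^sup>2)" by (intro member_le_sum) auto
  also have "\<dots> \<le> R\<^sup>2" using energy_bound[OF \<open>0 \<le> t\<close>] by simp
  finally show ?thesis using R_pos by (auto intro: power2_le_imp_le)
qed

lemma square_der:
  "0 \<le> t \<Longrightarrow> ((\<lambda>t. (cmod (w l t))\<^sup>2) has_real_derivative 2 * (w l t \<bullet> field l t)) (at t within {0..})"
  by (rule has_real_derivative_norm_square[OF ode])

text \<open>At amplitude \<open>r0\<close> the reaction term equals \<open>c * R * lambda_max (laplacian A)\<close>, while the force exerted
  by the neighbours is strictly smaller by \<open>complex_coupling_le\<close> and \<open>energy_bound\<close>; the
  amplitude is therefore growing.\<close>

lemma amplitude_lower: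
  assumes "0 \<le> t"
  shows "r0 < cmod (w l t)"
proof -
  have "0 < (cmod (w l t))\<^sup>2 - r0\<^sup>2"
  proof (rule family_stays_positive[where s = 0 and f = "\<lambda>l t. (cmod (w l t))\<^sup>2 - r0\<^sup>2"
        and f' = "\<lambda>l t. 2 * (w l t \<bullet> field l t)"])
    show "((\<lambda>t. (cmod (w i t))\<^sup>2 - r0\<^sup>2) has_real_derivative 2 * (w i t \<bullet> field i t)) (at t within {0..})"
      if "0 \<le> t" for i t
      using DERIV_diff[OF square_der[OF that] DERIV_const] by simp
  next
    show "0 < (cmod (w i 0))\<^sup>2 - r0\<^sup>2" for i
      using power_strict_mono[OF amplitude_init, of 2 i] r0_pos by simp
  next
    fix i and t :: real assume "0 \<le> t" "(cmod (w i t))\<^sup>2 - r0\<^sup>2 = 0"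
    then have amp: "cmod (w i t) = r0" using r0_pos by (simp add: power2_eq_iff_nonneg)
    define C where "C k = (\<Sum>j\<in>UNIV. A $ k $ j *\<^sub>R (w j t - w k t))" for k
    have "(cmod (C i))\<^sup>2 \<le> (\<Sum>k\<in>UNIV. (cmod (C k))\<^sup>2)" by (intro member_le_sum) auto
    also have "\<dots> \<le> (lambda_max (laplacian A))\<^sup>2 * (\<Sum>l\<in>UNIV. (cmod (w l t))\<^sup>2)"
      unfolding C_def by (rule complex_coupling_le[OF A_sym A_nonneg])
    also have "\<dots> < (lambda_max (laplacian A))\<^sup>2 * R\<^sup>2"
      using energy_bound[OF \<open>0 \<le> t\<close>] lambda_pos by simp
    finally have "(cmod (C i))\<^sup>2 < (R * lambda_max (laplacian A))\<^sup>2"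
      by (simp add: power_mult_distrib mult.commute)
    then have "cmod (C i) < R * lambda_max (laplacian A)"
      using R_pos lambda_pos by (auto intro: power2_less_imp_less)
    have "- (w i t \<bullet> C i) \<le> r0 * cmod (C i)"
      using Cauchy_Schwarz_ineq2[of "w i t" "C i"] amp by simp
    also have "\<dots> < r0 * (R * lambda_max (laplacian A))"
      using \<open>cmod (C i) < R * lambda_max (laplacian A)\<close> r0_pos by simp
    finally have "0 < c * (r0 * (R * lambda_max (laplacian A)) + w i t \<bullet> C i)"
      using c_pos by simp
    also have "\<dots> = r0 * (\<mu> * r0 - r0 ^ 3) + c * (w i t \<bullet> C i)"
      unfolding r0_root by (simp add: R_def algebra_simps)
    also have "\<dots> = w i t \<bullet> field i t"
      by (simp add: network_field_def C_def inner_add_right amp dot_square_norm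
          power2_eq_square power3_eq_cube algebra_simps)
    finally show "0 < 2 * (w i t \<bullet> field i t)" by simp
  qed fact
  then show ?thesis by (auto intro: power2_less_imp_less)
qed

section \<open>Synchronization of phases\<close>

abbreviation "x l t \<equiv> Re (w l t)"
abbreviation "y l t \<equiv> Im (w l t)"

lemma x_der: "0 \<le> t \<Longrightarrow> (x l has_real_derivative
      (\<mu> - (cmod (w l t))\<^sup>2) * x l t + c * (\<Sum>k\<in>UNIV. A $ l $ k * (x k t - x l t))) (at t within {0..})"
  and y_der: "0 \<le> t \<Longrightarrow> (y l has_real_derivative
      (\<mu> - (cmod (w l t))\<^sup>2) * y l t + c * (\<Sum>k\<in>UNIV. A $ l $ k * (y k t - y l t))) (at t within {0..})"
  using bounded_linear.has_vector_derivative[OF bounded_linear_Re ode[of t l]]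
    bounded_linear.has_vector_derivative[OF bounded_linear_Im ode[of t l]]
  by (simp_all add: has_real_derivative_iff_has_vector_derivative network_field_def)

text \<open>The smallest imaginary part is not lowered by the coupling, and the reaction term makes it decay at
  most at the rate \<open>R\<^sup>2\<close>.\<close>

lemma y_pos:
  assumes "0 \<le> t"
  shows "0 < y l t"
proof -
  define \<eta> where "\<eta> = Min (range (\<lambda>l. y l 0)) / 2"
  have "0 < Min (range (\<lambda>l. y l 0))" using upper_half_plane_init by simp
  then have "0 < \<eta>" by (simp add: \<eta>_def)
  have "\<eta> < y l 0" for l
  proof -
    have "Min (range (\<lambda>l. y l 0)) \<le> y l 0" by simp
    then show ?thesis using \<open>0 < \<eta>\<close> unfolding \<eta>_def by linarith
  qed
  define K where "K = R\<^sup>2 + 1"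
  define f' where "f' l t = (\<mu> - (cmod (w l t))\<^sup>2) * y l t +
      c * (\<Sum>k\<in>UNIV. A $ l $ k * (y k t - y l t)) + K * \<eta> * exp (- K * t)" for l t
  have "0 < y l t - \<eta> * exp (- K * t)"
  proof (rule family_stays_positive[where s = 0 and f = "\<lambda>l t. y l t - \<eta> * exp (- K * t)" and f' = f'])
    fix i and t :: real assume "0 \<le> t"
    have "((\<lambda>t. \<eta> * exp (- K * t)) has_real_derivative - (K * \<eta> * exp (- K * t))) (at t within {0..})"
      by (auto intro!: derivative_eq_intros)
    from DERIV_diff[OF y_der[OF \<open>0 \<le> t\<close>] this]
    show "((\<lambda>t. y i t - \<eta> * exp (- K * t)) has_real_derivative f' i t) (at t within {0..})"
      by (simp add: f'_def)
  next
    show "0 < y i 0 - \<eta> * exp (- K * 0)" for i using \<open>\<eta> < y i 0\<close> by simp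
  next
    fix i and t :: real
    assume "0 \<le> t" and touch: "y i t - \<eta> * exp (- K * t) = 0"
      and ge: "\<And>j. 0 \<le> y j t - \<eta> * exp (- K * t)"
    define b where "b = \<eta> * exp (- K * t)"
    have "0 < b" using \<open>0 < \<eta>\<close> by (simp add: b_def)
    have "0 \<le> c * (\<Sum>k\<in>UNIV. A $ i $ k * (y k t - y i t))"
      using touch ge c_pos A_nonneg by (intro mult_nonneg_nonneg sum_nonneg) auto
    moreover have "- R\<^sup>2 * b \<le> (\<mu> - (cmod (w i t))\<^sup>2) * b"
      using power_mono[OF amplitude_upper[OF \<open>0 \<le> t\<close>, of i], where n = 2] \<open>0 < b\<close> mu_pos
      by (intro mult_right_mono) auto
    moreover have "y i t = b" using touch by (simp add: b_def)
    ultimately show "0 < f' i t" using \<open>0 < b\<close> by (simp add: f'_def K_def b_def algebra_simps)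
  qed fact
  moreover have "0 < \<eta> * exp (- K * t)" using \<open>0 < \<eta>\<close> by simp
  ultimately show ?thesis by linarith
qed

text \<open>The cotangent of the phase.\<close>

definition "\<rho> l t = x l t / y l t"

definition "weight l k t = c * A $ l $ k * y k t / y l t"

text \<open>In \<open>x' * y - x * y'\<close> the common factor \<open>\<mu> - (cmod (w l t))\<^sup>2\<close> of both coordinates cancels, and what
  is left of the coupling is linear in the differences of the cotangents.\<close>

lemma rho_der:
  assumes "0 \<le> t"
  shows "(\<rho> l has_real_derivative (\<Sum>k\<in>UNIV. weight l k t * (\<rho> k t - \<rho> l t))) (at t within {0..})"
proof -
  have y: "y k t \<noteq> 0" for k using y_pos[OF assms, of k] by simp
  define a where "a = \<mu> - (cmod (w l t))\<^sup>2"
  define X Y where "X = (\<Sum>k\<in>UNIV. A $ l $ k * (x k t - x l t))"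
    and "Y = (\<Sum>k\<in>UNIV. A $ l $ k * (y k t - y l t))"
  have "(\<rho> l has_real_derivative
      ((a * x l t + c * X) * y l t - x l t * (a * y l t + c * Y)) / (y l t * y l t)) (at t within {0..})"
    unfolding \<rho>_def a_def X_def Y_def using y by (intro DERIV_divide x_der y_der assms)
  moreover have "((a * x l t + c * X) * y l t - x l t * (a * y l t + c * Y)) =
      (\<Sum>k\<in>UNIV. c * A $ l $ k * (x k t * y l t - x l t * y k t))"
    by (simp add: X_def Y_def sum_distrib_left sum_distrib_right sum_subtractf[symmetric] algebra_simps)
  moreover have "\<dots> / (y l t * y l t) = (\<Sum>k\<in>UNIV. weight l k t * (\<rho> k t - \<rho> l t))"
    unfolding sum_divide_distrib
    by (intro sum.cong refl) (simp add: weight_def \<rho>_def field_simps y)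
  ultimately show ?thesis by simp
qed

lemma weight_nonneg: "0 \<le> t \<Longrightarrow> 0 \<le> weight l k t"
  using y_pos[of t l] y_pos[of t k] c_pos A_nonneg by (simp add: weight_def)

lemma square_amplitude: "0 \<le> t \<Longrightarrow> (cmod (w l t))\<^sup>2 = (y l t)\<^sup>2 * (1 + (\<rho> l t)\<^sup>2)"
  using y_pos[of t l] by (simp add: cmod_power2 \<rho>_def field_simps)

lemma rho_bounded: obtains Q where "0 < Q" and "\<And>l t. 0 \<le> t \<Longrightarrow> \<bar>\<rho> l t\<bar> \<le> Q"
proof
  define Q where "Q = (\<Sum>l\<in>UNIV. \<bar>\<rho> l 0\<bar>) + 1"
  show "0 < Q" unfolding Q_def by (intro add_nonneg_pos sum_nonneg) auto
  have "\<bar>\<rho> k 0\<bar> \<le> (\<Sum>l\<in>UNIV. \<bar>\<rho> l 0\<bar>)" for k by (rule member_le_sum) auto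
  then have init: "\<bar>\<rho> k 0\<bar> \<le> Q" for k unfolding Q_def by (rule add_increasing2[OF zero_le_one])
  fix l and t :: real assume "0 \<le> t"
  have "\<rho> l t \<le> Q"
    using init by (intro consensus_upper_bound[OF rho_der weight_nonneg _ \<open>0 \<le> t\<close>]) (auto simp: abs_le_iff)
  moreover have "- Q \<le> \<rho> l t"
    using init by (intro consensus_lower_bound[OF rho_der weight_nonneg _ \<open>0 \<le> t\<close>]) (auto simp: abs_le_iff minus_le_iff)
  ultimately show "\<bar>\<rho> l t\<bar> \<le> Q" by simp
qed

lemma y_upper: "0 \<le> t \<Longrightarrow> y l t \<le> R"
  using amplitude_upper[of t l] abs_Im_le_cmod[of "w l t"] by linarith

text \<open>Amplitudes above \<open>r0\<close> and bounded cotangents keep the nodes away from the real axis.\<close>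

lemma y_lower: obtains b where "0 < b" and "\<And>l t. 0 \<le> t \<Longrightarrow> b \<le> y l t"
proof -
  obtain Q where Q: "0 < Q" "\<And>l t. 0 \<le> t \<Longrightarrow> \<bar>\<rho> l t\<bar> \<le> Q" using rho_bounded by blast
  define q where "q = sqrt (1 + Q\<^sup>2)"
  have q: "0 < q" "q\<^sup>2 = 1 + Q\<^sup>2" by (auto simp: q_def add_pos_nonneg)
  have "r0 / q \<le> y l t" if "0 \<le> t" for l t
  proof -
    have "r0\<^sup>2 \<le> (y l t)\<^sup>2 * (1 + (\<rho> l t)\<^sup>2)"
      using power_mono[OF less_imp_le[OF amplitude_lower[OF that, of l]], where n = 2] r0_pos
      by (simp add: square_amplitude[OF that])
    also have "\<dots> \<le> (y l t)\<^sup>2 * q\<^sup>2"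
      using power_mono[OF Q(2)[OF that, of l], where n = 2] by (intro mult_left_mono) (auto simp: q)
    finally have "r0\<^sup>2 \<le> (y l t * q)\<^sup>2" by (simp add: power_mult_distrib)
    then have "r0 \<le> y l t * q" using y_pos[OF that, of l] q by (auto intro: power2_le_imp_le)
    then show ?thesis using q by (simp add: pos_divide_le_eq)
  qed
  then show thesis using that[of "r0 / q"] q r0_pos by simp
qed

lemma rho_converges: obtains r where "\<And>l. exp_converges (\<rho> l) r"
proof -
  obtain b where b: "0 < b" "\<And>l t. 0 \<le> t \<Longrightarrow> b \<le> y l t" using y_lower by blast
  show thesis
  proof (rule consensus_exponential[where \<rho> = \<rho> and W = weight and wmin = "c * b / R"
        and wmax = "\<Sum>k\<in>(UNIV :: 'n set). c * 1 * R / b" and E = "{(i, j). A $ i $ j = 1}"])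
    fix l k and t :: real assume "0 \<le> t"
    show "(\<Sum>k\<in>UNIV. weight l k t) \<le> (\<Sum>k\<in>(UNIV :: 'n set). c * 1 * R / b)"
      unfolding weight_def using b \<open>0 \<le> t\<close> c_pos A_nonneg A_le_1 y_upper R_pos
      by (intro sum_mono frac_le mult_mono) (auto intro: order_trans less_imp_le[OF y_pos])
    show "c * b / R \<le> weight l k t" if "(l, k) \<in> {(i, j). A $ i $ j = 1}"
      unfolding weight_def using that b \<open>0 \<le> t\<close> c_pos y_upper R_pos y_pos
      by (auto intro!: frac_le mult_mono mult_nonneg_nonneg less_imp_le[OF y_pos])
  next
    fix r assume "\<And>l. exp_converges (\<rho> l) r"
    then show thesis by (rule that)
  qed (use rho_der weight_nonneg connected b c_pos R_pos in auto)
qed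

section \<open>Synchronization of amplitudes\<close>

text \<open>With \<open>u\<close> and \<open>v\<close> the moduli of \<open>\<rho> + \<i>\<close> at the two nodes, the law of cosines gives
  \<open>2 * (u * v - (1 + \<rho> k * \<rho> l)) = (\<rho> k - \<rho> l)\<^sup>2 - (u - v)\<^sup>2\<close>.  So the loss in the Cauchy-Schwarz
  inequality is quadratic in the difference of the cotangents.\<close>

lemma inner_lower:
  assumes "0 \<le> t"
  shows "cmod (w k t) * cmod (w l t) - R\<^sup>2 / 2 * (\<rho> k t - \<rho> l t)\<^sup>2 \<le> w k t \<bullet> w l t"
proof -
  have polar: "cmod (w j t) = y j t * cmod (Complex (\<rho> j t) 1)" "x j t = y j t * \<rho> j t" for j
  proof -
    have y: "0 < y j t" by (rule y_pos[OF assms])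
    then show "x j t = y j t * \<rho> j t" by (simp add: \<rho>_def)
    then have "w j t = y j t *\<^sub>R Complex (\<rho> j t) 1" by (simp add: complex_eq_iff)
    then have "cmod (w j t) = cmod (y j t *\<^sub>R Complex (\<rho> j t) 1)" by (rule arg_cong)
    then show "cmod (w j t) = y j t * cmod (Complex (\<rho> j t) 1)" using y by simp
  qed
  define u v where "u = cmod (Complex (\<rho> k t) 1)" and "v = cmod (Complex (\<rho> l t) 1)"
  have uv: "u\<^sup>2 = 1 + (\<rho> k t)\<^sup>2" "v\<^sup>2 = 1 + (\<rho> l t)\<^sup>2" by (simp_all add: u_def v_def cmod_power2)
  have "u * v - (1 + \<rho> k t * \<rho> l t) = ((\<rho> k t - \<rho> l t)\<^sup>2 - (u - v)\<^sup>2) / 2"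
    using uv by (simp add: power2_eq_square algebra_simps)
  also have "\<dots> \<le> (\<rho> k t - \<rho> l t)\<^sup>2 / 2" by simp
  finally have "y k t * y l t * (u * v - (1 + \<rho> k t * \<rho> l t)) \<le>
      y k t * y l t * ((\<rho> k t - \<rho> l t)\<^sup>2 / 2)"
    using y_pos[OF assms] by (intro mult_left_mono) (auto intro: less_imp_le)
  also have "\<dots> \<le> (R * R) * ((\<rho> k t - \<rho> l t)\<^sup>2 / 2)"
    using y_pos[OF assms] y_upper[OF assms] R_pos
    by (intro mult_right_mono mult_mono) (auto intro: less_imp_le)
  finally show ?thesis
    unfolding polar inner_complex_def u_def[symmetric] v_def[symmetric]
    by (simp add: power2_eq_square algebra_simps)
qed

lemma rho_bounded_differences: obtains Q where "0 < Q" and "\<And>l k t. 0 \<le> t \<Longrightarrow> \<bar>\<rho> k t - \<rho> l t\<bar> \<le> Q"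
proof -
  obtain Q where Q: "0 < Q" "\<And>l t. 0 \<le> t \<Longrightarrow> \<bar>\<rho> l t\<bar> \<le> Q" using rho_bounded by blast
  have "\<bar>\<rho> k t - \<rho> l t\<bar> \<le> 2 * Q" if "0 \<le> t" for l k t
    using Q(2)[OF that, of l] Q(2)[OF that, of k] by linarith
  then show thesis using that[of "2 * Q"] Q(1) by simp
qed

text \<open>At a contact point the amplitude of node \<open>i\<close> is maximal, so the coupling pulls it down, and
  the reaction term lowers its square at a rate of at least \<open>2 * \<mu>\<close> times the height above \<open>\<mu>\<close>.\<close>

lemma amplitude_upper_barrier:
  assumes "0 < \<kappa>" "\<kappa> \<le> \<mu>" and "R\<^sup>2 \<le> C" and "0 \<le> t"
  shows "(cmod (w l t))\<^sup>2 < \<mu> + C * exp (- \<kappa> * t)"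
proof -
  have "0 < C" using R_pos \<open>R\<^sup>2 \<le> C\<close> by (smt (verit) zero_less_power)
  have "0 < \<mu> + C * exp (- \<kappa> * t) - (cmod (w l t))\<^sup>2"
  proof (rule family_stays_positive[where s = 0 and
        f = "\<lambda>l t. \<mu> + C * exp (- \<kappa> * t) - (cmod (w l t))\<^sup>2" and
        f' = "\<lambda>l t. - (\<kappa> * C * exp (- \<kappa> * t)) - 2 * (w l t \<bullet> field l t)"])
    fix i and t :: real assume "0 \<le> t"
    have "((\<lambda>t. \<mu> + C * exp (- \<kappa> * t)) has_real_derivative - (\<kappa> * C * exp (- \<kappa> * t))) (at t within {0..})"
      by (auto intro!: derivative_eq_intros)
    from DERIV_diff[OF this square_der[OF \<open>0 \<le> t\<close>]]
    show "((\<lambda>t. \<mu> + C * exp (- \<kappa> * t) - (cmod (w i t))\<^sup>2) has_real_derivative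
        - (\<kappa> * C * exp (- \<kappa> * t)) - 2 * (w i t \<bullet> field i t)) (at t within {0..})" .
  next
    fix i
    have "(cmod (w i 0))\<^sup>2 \<le> R\<^sup>2" by (intro power_mono amplitude_upper) auto
    then show "0 < \<mu> + C * exp (- \<kappa> * 0) - (cmod (w i 0))\<^sup>2" using \<open>R\<^sup>2 \<le> C\<close> mu_pos by simp
  next
    fix i and t :: real
    assume "0 \<le> t" and touch: "\<mu> + C * exp (- \<kappa> * t) - (cmod (w i t))\<^sup>2 = 0"
      and ge: "\<And>j. 0 \<le> \<mu> + C * exp (- \<kappa> * t) - (cmod (w j t))\<^sup>2"
    define e where "e = C * exp (- \<kappa> * t)"
    have "0 < e" using \<open>0 < C\<close> by (simp add: e_def)
    have rate: "\<kappa> * C * exp (- \<kappa> * t) = \<kappa> * e" by (simp add: e_def)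
    have amp: "(cmod (w i t))\<^sup>2 = \<mu> + e" using touch by (simp add: e_def)
    have "w i t \<bullet> (w k t - w i t) \<le> 0" for k
    proof -
      have "(cmod (w k t))\<^sup>2 \<le> (cmod (w i t))\<^sup>2" using ge[of k] touch by linarith
      then have "cmod (w k t) \<le> cmod (w i t)" by (rule power2_le_imp_le) simp
      then have "cmod (w i t) * cmod (w k t) \<le> cmod (w i t) * cmod (w i t)"
        by (intro mult_left_mono) auto
      then show ?thesis
        using norm_cauchy_schwarz[of "w i t" "w k t"]
        by (simp add: inner_diff_right power2_norm_eq_inner[symmetric] power2_eq_square)
    qed
    then have "c * (\<Sum>k\<in>UNIV. A $ i $ k * (w i t \<bullet> (w k t - w i t))) \<le> 0"
      using c_pos A_nonneg by (intro mult_nonneg_nonpos sum_nonpos) auto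
    then have "w i t \<bullet> field i t \<le> - (e * (\<mu> + e))" by (simp add: inner_network_field[of "\<lambda>k. w k t"] amp)
    moreover have "\<kappa> * e \<le> \<mu> * e" "0 < \<mu> * e" "0 < e * e"
      using \<open>\<kappa> \<le> \<mu>\<close> \<open>0 < e\<close> mu_pos by auto
    ultimately show "0 < - (\<kappa> * C * exp (- \<kappa> * t)) - 2 * (w i t \<bullet> field i t)"
      unfolding rate by (simp add: distrib_left mult.commute)
  qed fact
  then show ?thesis by simp
qed

text \<open>At a contact point the amplitude of node \<open>i\<close> is minimal, so by \<open>inner_lower\<close> the coupling
  lowers it only through the phase differences.  The constant \<open>C\<close> is large enough for the
  reaction term, which is bounded from below by means of \<open>r0\<close>, to win against that error.\<close>

lemma amplitude_lower_barrier:
  assumes spread: "\<And>t l. 0 \<le> t \<Longrightarrow> c * (\<Sum>k\<in>UNIV. A $ l $ k * (R\<^sup>2 / 2 * (\<rho> k t - \<rho> l t)\<^sup>2)) \<le> K * exp (- \<gamma> * t)"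
    and "0 < \<kappa>" "\<kappa> \<le> r0\<^sup>2" "\<kappa> \<le> \<gamma>" and "\<mu> < C" "2 * K < C * r0\<^sup>2" "0 \<le> K" and "0 \<le> t"
  shows "\<mu> - C * exp (- \<kappa> * t) < (cmod (w l t))\<^sup>2"
proof -
  have "0 < C" using mu_pos \<open>\<mu> < C\<close> by simp
  have "0 < (cmod (w l t))\<^sup>2 - (\<mu> - C * exp (- \<kappa> * t))"
  proof (rule family_stays_positive[where s = 0 and
        f = "\<lambda>l t. (cmod (w l t))\<^sup>2 - (\<mu> - C * exp (- \<kappa> * t))" and
        f' = "\<lambda>l t. 2 * (w l t \<bullet> field l t) - \<kappa> * C * exp (- \<kappa> * t)"])
    fix i and t :: real assume "0 \<le> t"
    have "((\<lambda>t. \<mu> - C * exp (- \<kappa> * t)) has_real_derivative \<kappa> * C * exp (- \<kappa> * t)) (at t within {0..})"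
      by (auto intro!: derivative_eq_intros)
    from DERIV_diff[OF square_der[OF \<open>0 \<le> t\<close>] this]
    show "((\<lambda>t. (cmod (w i t))\<^sup>2 - (\<mu> - C * exp (- \<kappa> * t))) has_real_derivative
        2 * (w i t \<bullet> field i t) - \<kappa> * C * exp (- \<kappa> * t)) (at t within {0..})" .
  next
    fix i
    have "\<mu> - C < 0" using \<open>\<mu> < C\<close> by simp
    also have "0 \<le> (cmod (w i 0))\<^sup>2" by simp
    finally show "0 < (cmod (w i 0))\<^sup>2 - (\<mu> - C * exp (- \<kappa> * 0))" by simp
  next
    fix i and t :: real
    assume "0 \<le> t" and touch: "(cmod (w i t))\<^sup>2 - (\<mu> - C * exp (- \<kappa> * t)) = 0"
      and ge: "\<And>j. 0 \<le> (cmod (w j t))\<^sup>2 - (\<mu> - C * exp (- \<kappa> * t))"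
    define e where "e = C * exp (- \<kappa> * t)"
    have "0 < e" using \<open>0 < C\<close> by (simp add: e_def)
    have rate: "\<kappa> * C * exp (- \<kappa> * t) = \<kappa> * e" by (simp add: e_def)
    have amp: "(cmod (w i t))\<^sup>2 = \<mu> - e" using touch by (simp add: e_def)
    have "r0\<^sup>2 \<le> \<mu> - e"
      unfolding amp[symmetric] using amplitude_lower[OF \<open>0 \<le> t\<close>, of i] r0_pos
      by (intro power_mono) auto
    have "- (R\<^sup>2 / 2 * (\<rho> k t - \<rho> i t)\<^sup>2) \<le> w i t \<bullet> (w k t - w i t)" for k
    proof -
      have "(cmod (w i t))\<^sup>2 \<le> (cmod (w k t))\<^sup>2" using ge[of k] touch by linarith
      then have "cmod (w i t) \<le> cmod (w k t)" by (rule power2_le_imp_le) simp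
      then have "cmod (w i t) * cmod (w i t) \<le> cmod (w k t) * cmod (w i t)"
        by (intro mult_right_mono) auto
      then show ?thesis
        using inner_lower[OF \<open>0 \<le> t\<close>, of k i]
        by (simp add: inner_diff_right power2_norm_eq_inner[symmetric] power2_eq_square inner_commute)
    qed
    then have "(\<Sum>k\<in>UNIV. A $ i $ k * - (R\<^sup>2 / 2 * (\<rho> k t - \<rho> i t)\<^sup>2)) \<le>
        (\<Sum>k\<in>UNIV. A $ i $ k * (w i t \<bullet> (w k t - w i t)))"
      by (intro sum_mono mult_left_mono A_nonneg)
    then have "c * (\<Sum>k\<in>UNIV. A $ i $ k * - (R\<^sup>2 / 2 * (\<rho> k t - \<rho> i t)\<^sup>2)) \<le>
        c * (\<Sum>k\<in>UNIV. A $ i $ k * (w i t \<bullet> (w k t - w i t)))"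
      using c_pos by simp
    then have coupling: "- (K * exp (- \<gamma> * t)) \<le> c * (\<Sum>k\<in>UNIV. A $ i $ k * (w i t \<bullet> (w k t - w i t)))"
      using spread[OF \<open>0 \<le> t\<close>, of i] by (simp add: sum_negf)
    have "2 * (K * exp (- \<gamma> * t)) \<le> 2 * (K * exp (- \<kappa> * t))"
      using \<open>0 \<le> K\<close> \<open>\<kappa> \<le> \<gamma>\<close> \<open>0 \<le> t\<close> by (intro mult_left_mono) (auto intro!: mult_right_mono)
    also have "\<dots> < e * r0\<^sup>2"
      using \<open>2 * K < C * r0\<^sup>2\<close> by (simp add: e_def mult_ac)
    finally have "2 * (K * exp (- \<gamma> * t)) < e * r0\<^sup>2" .
    moreover have "e * r0\<^sup>2 \<le> e * (\<mu> - e)" "\<kappa> * e \<le> e * r0\<^sup>2"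
      using \<open>r0\<^sup>2 \<le> \<mu> - e\<close> \<open>0 < e\<close> \<open>\<kappa> \<le> r0\<^sup>2\<close> by (auto simp: mult.commute)
    moreover have "w i t \<bullet> field i t = e * (\<mu> - e) + c * (\<Sum>k\<in>UNIV. A $ i $ k * (w i t \<bullet> (w k t - w i t)))"
      by (simp add: inner_network_field[of "\<lambda>k. w k t"] amp)
    ultimately show "0 < 2 * (w i t \<bullet> field i t) - \<kappa> * C * exp (- \<kappa> * t)"
      using coupling unfolding rate by simp
  qed fact
  then show ?thesis by simp
qed

text \<open>Both barriers apply with one rate \<open>\<kappa>\<close> and one constant \<open>C\<close>; the error that the lower
  barrier has to absorb decays because the cotangents have a common limit.\<close>

lemma square_amplitude_converges: "exp_converges (\<lambda>t. (cmod (w l t))\<^sup>2) \<mu>"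
proof -
  obtain r where r: "\<And>l. exp_converges (\<rho> l) r" using rho_converges by blast
  obtain Q where Q: "0 < Q" "\<And>l k t. 0 \<le> t \<Longrightarrow> \<bar>\<rho> k t - \<rho> l t\<bar> \<le> Q"
    using rho_bounded_differences by blast
  have square: "exp_converges (\<lambda>t. (\<rho> k t - \<rho> l t)\<^sup>2) 0" for k l
  proof (rule exp_converges_bound[OF exp_converges_diff[OF r r]])
    show "\<bar>(\<rho> k t - \<rho> l t)\<^sup>2 - 0\<bar> \<le> Q * \<bar>\<rho> k t - \<rho> l t\<bar>" if "0 \<le> t" for t
      using Q(2)[OF that, of k l] mult_right_mono[of "\<bar>\<rho> k t - \<rho> l t\<bar>" Q "\<bar>\<rho> k t - \<rho> l t\<bar>"]
      by (simp add: power2_eq_square abs_mult)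
  qed
  define g where "g l t = c * (\<Sum>k\<in>UNIV. A $ l $ k * (R\<^sup>2 / 2 * (\<rho> k t - \<rho> l t)\<^sup>2))" for l t
  have "0 \<le> g l t" for l t
    unfolding g_def using c_pos A_nonneg by (intro mult_nonneg_nonneg sum_nonneg) auto
  have "exp_converges (\<lambda>t. \<Sum>l\<in>UNIV. g l t) 0"
    unfolding g_def by (intro exp_converges_sum exp_converges_mult_left square finite_class.finite_UNIV)
  then obtain K \<gamma> where K: "0 < K" "0 < \<gamma>" "\<And>t. 0 \<le> t \<Longrightarrow> \<bar>(\<Sum>l\<in>UNIV. g l t) - 0\<bar> \<le> K * exp (- \<gamma> * t)"
    unfolding exp_converges_def by blast
  have spread: "g l t \<le> K * exp (- \<gamma> * t)" if "0 \<le> t" for l t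
  proof -
    have "g l t \<le> (\<Sum>l\<in>UNIV. g l t)" by (rule member_le_sum) (auto simp: \<open>\<And>l t. 0 \<le> g l t\<close>)
    then show ?thesis using K(3)[OF that] by linarith
  qed
  define \<kappa> where "\<kappa> = min \<mu> (min (r0\<^sup>2) \<gamma>)"
  have \<kappa>: "0 < \<kappa>" "\<kappa> \<le> \<mu>" "\<kappa> \<le> r0\<^sup>2" "\<kappa> \<le> \<gamma>"
    using mu_pos r0_pos K(2) by (auto simp: \<kappa>_def)
  \<comment> \<open>The summands of \<open>C\<close> serve the initial condition of the upper barrier, that of the lower barrier,
    and the error term, respectively.\<close>
  define C where "C = R\<^sup>2 + \<mu> + 1 + 2 * K / r0\<^sup>2"
  have "0 < 2 * K / r0\<^sup>2" using K(1) r0_pos by simp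
  then have C: "0 < C" "R\<^sup>2 \<le> C" "\<mu> < C" "2 * K / r0\<^sup>2 < C"
    using mu_pos zero_le_power2[of R] unfolding C_def by linarith+
  then have "2 * K < C * r0\<^sup>2" using r0_pos by (simp add: pos_divide_less_eq)
  have "\<bar>(cmod (w l t))\<^sup>2 - \<mu>\<bar> \<le> C * exp (- \<kappa> * t)" if "0 \<le> t" for t
    using amplitude_upper_barrier[OF \<kappa>(1,2) C(2) that, of l]
      amplitude_lower_barrier[OF spread[unfolded g_def] \<kappa>(1,3,4) C(3) \<open>2 * K < C * r0\<^sup>2\<close> less_imp_le[OF K(1)] that, of l]
    by linarith
  then show ?thesis unfolding exp_converges_def using \<open>0 < C\<close> \<kappa>(1) by blast
qed

lemma amplitude_converges: "exp_converges (\<lambda>t. cmod (w l t)) (sqrt \<mu>)"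
proof -
  have "exp_converges (\<lambda>t. (cmod (w l t))\<^sup>2 - \<mu>) 0"
    using square_amplitude_converges by (simp add: exp_converges_def)
  then show ?thesis
  proof (rule exp_converges_bound)
    fix t :: real assume "0 \<le> t"
    have "(cmod (w l t))\<^sup>2 - \<mu> = (cmod (w l t) - sqrt \<mu>) * (cmod (w l t) + sqrt \<mu>)"
      using mu_pos by (simp add: algebra_simps power2_eq_square)
    then have "\<bar>(cmod (w l t))\<^sup>2 - \<mu>\<bar> = \<bar>cmod (w l t) - sqrt \<mu>\<bar> * (cmod (w l t) + sqrt \<mu>)"
      using mu_pos by (simp add: abs_mult)
    moreover have "\<bar>cmod (w l t) - sqrt \<mu>\<bar> * sqrt \<mu> \<le> \<bar>cmod (w l t) - sqrt \<mu>\<bar> * (cmod (w l t) + sqrt \<mu>)"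
      by (intro mult_left_mono) auto
    ultimately show "\<bar>cmod (w l t) - sqrt \<mu>\<bar> \<le> 1 / sqrt \<mu> * \<bar>(cmod (w l t))\<^sup>2 - \<mu>\<bar>"
      using mu_pos by (simp add: pos_le_divide_eq)
  qed
qed

text \<open>The angle of \<open>w l t\<close> in the open upper half-plane, written through the cotangent \<open>\<rho>\<close>.\<close>

definition "angle l t = pi / 2 - arctan (\<rho> l t)"

lemma angle_range: "0 < angle l t" "angle l t < pi"
  using arctan_bounded[of "\<rho> l t"] by (auto simp: angle_def)

lemma polar_form:
  assumes "0 \<le> t"
  shows "w l t = rcis (cmod (w l t)) (angle l t)"
proof -
  have y: "0 < y l t" by (rule y_pos[OF assms])
  have "cmod (w l t) = sqrt ((y l t)\<^sup>2 * (1 + (\<rho> l t)\<^sup>2))"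
    by (simp add: square_amplitude[OF assms, symmetric])
  then have amp: "cmod (w l t) = y l t * sqrt (1 + (\<rho> l t)\<^sup>2)"
    using y by (simp add: real_sqrt_mult)
  have "sqrt (1 + (\<rho> l t)\<^sup>2) \<noteq> 0" by (simp add: add_nonneg_eq_0_iff)
  moreover have "y l t * \<rho> l t = x l t" using y by (simp add: \<rho>_def)
  ultimately show ?thesis
    unfolding amp angle_def
    by (simp add: complex_eq_iff cos_diff sin_diff sin_arctan cos_arctan)
qed

lemma angle_der:
  assumes "0 \<le> t"
  shows "(angle l has_real_derivative
    - (\<Sum>k\<in>UNIV. weight l k t * (\<rho> k t - \<rho> l t)) / (1 + (\<rho> l t)\<^sup>2)) (at t within {0..})"
proof -
  have "(angle l has_real_derivative
      0 - inverse (1 + (\<rho> l t)\<^sup>2) * (\<Sum>k\<in>UNIV. weight l k t * (\<rho> k t - \<rho> l t))) (at t within {0..})"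
    unfolding angle_def[abs_def]
    by (rule DERIV_diff[OF DERIV_const DERIV_chain2[OF DERIV_arctan rho_der[OF assms]]])
  moreover have "0 - inverse d * s = - s / d" for d s :: real by (simp add: divide_inverse)
  ultimately show ?thesis by (simp only:)
qed

lemma amplitude_der:
  assumes "0 \<le> t"
  shows "((\<lambda>t. cmod (w l t)) has_real_derivative (w l t \<bullet> field l t) / cmod (w l t)) (at t within {0..})"
proof -
  have pos: "0 < cmod (w l t)" using amplitude_lower[OF assms, of l] r0_pos by linarith
  have "((\<lambda>t. sqrt ((cmod (w l t))\<^sup>2)) has_real_derivative
      inverse (sqrt ((cmod (w l t))\<^sup>2)) / 2 * (2 * (w l t \<bullet> field l t))) (at t within {0..})"
    using pos by (intro DERIV_chain2[OF DERIV_real_sqrt square_der[OF assms]]) simp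
  then show ?thesis by (simp add: field_simps)
qed

lemma angle_der_converges:
  "exp_converges (\<lambda>t. - (\<Sum>k\<in>UNIV. weight l k t * (\<rho> k t - \<rho> l t)) / (1 + (\<rho> l t)\<^sup>2)) 0"
proof -
  obtain r where r: "\<And>l. exp_converges (\<rho> l) r" using rho_converges by blast
  obtain b where b: "0 < b" "\<And>l t. 0 \<le> t \<Longrightarrow> b \<le> y l t" using y_lower by blast
  define B where "B = c * 1 * R / b"
  have "exp_converges (\<lambda>t. \<Sum>k\<in>UNIV. \<bar>\<rho> k t - \<rho> l t\<bar>) 0"
    using exp_converges_diff[OF r r] by (intro exp_converges_sum) (auto simp: exp_converges_abs_iff)
  then show ?thesis
  proof (rule exp_converges_bound)
    fix t :: real assume "0 \<le> t"
    have W: "weight l k t \<le> B" for k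
      unfolding weight_def B_def using b \<open>0 \<le> t\<close> c_pos A_nonneg A_le_1 y_upper R_pos
      by (intro frac_le mult_mono) (auto intro: order_trans less_imp_le[OF y_pos])
    have "\<bar>- (\<Sum>k\<in>UNIV. weight l k t * (\<rho> k t - \<rho> l t)) / (1 + (\<rho> l t)\<^sup>2)\<bar> \<le>
        \<bar>\<Sum>k\<in>UNIV. weight l k t * (\<rho> k t - \<rho> l t)\<bar> / 1"
      unfolding abs_divide abs_minus_cancel by (intro frac_le) auto
    also have "\<dots> \<le> (\<Sum>k\<in>UNIV. \<bar>weight l k t * (\<rho> k t - \<rho> l t)\<bar>)"
      by simp
    also have "\<dots> \<le> (\<Sum>k\<in>UNIV. B * \<bar>\<rho> k t - \<rho> l t\<bar>)"
      unfolding abs_mult using W weight_nonneg[OF \<open>0 \<le> t\<close>]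
      by (intro sum_mono mult_right_mono) auto
    also have "\<dots> = B * \<bar>\<Sum>k\<in>UNIV. \<bar>\<rho> k t - \<rho> l t\<bar>\<bar>"
      by (simp add: sum_distrib_left abs_of_nonneg sum_nonneg)
    finally show "\<bar>- (\<Sum>k\<in>UNIV. weight l k t * (\<rho> k t - \<rho> l t)) / (1 + (\<rho> l t)\<^sup>2) - 0\<bar>
      \<le> B * \<bar>\<Sum>k\<in>UNIV. \<bar>\<rho> k t - \<rho> l t\<bar>\<bar>" by simp
  qed
qed

text \<open>The arctangent and the unit circle parametrization do not increase distances, so the rates of the
  cotangents and of the amplitudes pass to the phases and to the states.\<close>

lemma angle_and_state_converge:
  obtains \<phi> where "0 < \<phi>" "\<phi> < pi" "\<And>l. exp_converges (angle l) \<phi>"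
    and "\<And>l. exp_converges (\<lambda>t. cmod (w l t - sqrt \<mu> *\<^sub>R cis \<phi>)) 0"
proof -
  obtain r where r: "\<And>l. exp_converges (\<rho> l) r" using rho_converges by blast
  define \<phi> where "\<phi> = pi / 2 - arctan r"
  have range: "0 < \<phi>" "\<phi> < pi" using arctan_bounded[of r] by (auto simp: \<phi>_def)
  have angle: "exp_converges (angle l) \<phi>" for l
  proof (rule exp_converges_bound[where K = 1])
    show "exp_converges (\<lambda>t. \<rho> l t - r) 0" using r[of l] by (simp add: exp_converges_def)
    fix t :: real
    have "\<bar>arctan a - arctan b\<bar> \<le> \<bar>a - b\<bar>" for a b :: real
    proof (induction a b rule: linorder_wlog)
      case (le a b)
      have "((\<lambda>x. arctan x - x) has_real_derivative inverse (1 + x\<^sup>2) - 1) (at x within {a..b})" for x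
        by (auto intro!: derivative_eq_intros)
      then have "arctan b - b \<le> arctan a - a"
        by (rule nonincreasing_of_deriv_nonpos[OF le]) (simp add: inverse_le_1_iff)
      then show ?case using arctan_monotone'[OF le] le by simp
    qed (simp add: abs_minus_commute)
    then show "\<bar>angle l t - \<phi>\<bar> \<le> 1 * \<bar>\<rho> l t - r\<bar>"
      by (simp add: angle_def \<phi>_def abs_minus_commute)
  qed
  have "exp_converges (\<lambda>t. cmod (w l t - sqrt \<mu> *\<^sub>R cis \<phi>)) 0" for l
  proof (rule exp_converges_bound[where K = 1])
    have "exp_converges (\<lambda>t. \<bar>cmod (w l t) - sqrt \<mu>\<bar>) 0" "exp_converges (\<lambda>t. \<bar>angle l t - \<phi>\<bar>) 0"
      using angle[of l] amplitude_converges[of l] by (simp_all add: exp_converges_def)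
    then show "exp_converges (\<lambda>t. \<bar>cmod (w l t) - sqrt \<mu>\<bar> + sqrt \<mu> * \<bar>angle l t - \<phi>\<bar>) 0"
      by (intro exp_converges_add exp_converges_mult_left)
    fix t :: real assume "0 \<le> t"
    have "w l t - sqrt \<mu> *\<^sub>R cis \<phi> =
        (cmod (w l t) - sqrt \<mu>) *\<^sub>R cis (angle l t) + sqrt \<mu> *\<^sub>R (cis (angle l t) - cis \<phi>)"
      by (subst polar_form[OF \<open>0 \<le> t\<close>]) (simp add: rcis_def scaleR_conv_of_real algebra_simps)
    then have "cmod (w l t - sqrt \<mu> *\<^sub>R cis \<phi>) \<le>
        cmod ((cmod (w l t) - sqrt \<mu>) *\<^sub>R cis (angle l t)) + cmod (sqrt \<mu> *\<^sub>R (cis (angle l t) - cis \<phi>))"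
      by (metis norm_triangle_ineq)
    also have "\<dots> = \<bar>cmod (w l t) - sqrt \<mu>\<bar> + sqrt \<mu> * cmod (cis (angle l t) - cis \<phi>)"
      using mu_pos by simp
    also have "cmod (cis (angle l t) - cis \<phi>) \<le> \<bar>angle l t - \<phi>\<bar>"
      by (rule norm_cis_diff_le)
    finally show "\<bar>cmod (w l t - sqrt \<mu> *\<^sub>R cis \<phi>) - 0\<bar> \<le>
        1 * \<bar>\<bar>cmod (w l t) - sqrt \<mu>\<bar> + sqrt \<mu> * \<bar>angle l t - \<phi>\<bar>\<bar>"
      using mu_pos by simp
  qed
  then show thesis using that range angle by blast
qed

lemma amplitude_der_converges: "exp_converges (\<lambda>t. (w l t \<bullet> field l t) / cmod (w l t)) 0"
proof -
  obtain \<phi> where state: "\<And>l. exp_converges (\<lambda>t. cmod (w l t - sqrt \<mu> *\<^sub>R cis \<phi>)) 0"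
    using angle_and_state_converge by metis
  have diff: "exp_converges (\<lambda>t. cmod (w k t - w l t)) 0" for k
    by (rule exp_converges_bound[OF exp_converges_add[OF state[of k] state[of l]], where K = 1])
       (use norm_triangle_ineq4[of "w k t - sqrt \<mu> *\<^sub>R cis \<phi>" "w l t - sqrt \<mu> *\<^sub>R cis \<phi>" for t] in simp)
  have "exp_converges (\<lambda>t. \<bar>(cmod (w l t))\<^sup>2 - \<mu>\<bar>) 0"
    using square_amplitude_converges by (simp add: exp_converges_def)
  then have "exp_converges (\<lambda>t. R * \<bar>(cmod (w l t))\<^sup>2 - \<mu>\<bar> +
      c * (\<Sum>k\<in>UNIV. A $ l $ k * cmod (w k t - w l t))) 0"
    by (intro exp_converges_add exp_converges_mult_left exp_converges_sum diff) auto
  then show ?thesis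
  proof (rule exp_converges_bound)
    fix t :: real assume "0 \<le> t"
    define C where "C = (\<Sum>k\<in>UNIV. A $ l $ k *\<^sub>R (w k t - w l t))"
    have pos: "0 < cmod (w l t)" using amplitude_lower[OF \<open>0 \<le> t\<close>, of l] r0_pos by linarith
    have "\<bar>w l t \<bullet> field l t\<bar> \<le> cmod (w l t) * cmod (field l t)" by (rule Cauchy_Schwarz_ineq2)
    then have "\<bar>(w l t \<bullet> field l t) / cmod (w l t)\<bar> \<le> cmod (field l t)"
      using pos by (simp add: abs_divide pos_divide_le_eq mult.commute)
    also have "\<dots> \<le> cmod ((\<mu> - (cmod (w l t))\<^sup>2) *\<^sub>R w l t) + cmod (c *\<^sub>R C)"
      unfolding network_field_def C_def by (rule norm_triangle_ineq)
    also have "\<dots> = \<bar>(cmod (w l t))\<^sup>2 - \<mu>\<bar> * cmod (w l t) + c * cmod C"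
      using c_pos by (simp add: abs_minus_commute)
    also have "\<dots> \<le> \<bar>(cmod (w l t))\<^sup>2 - \<mu>\<bar> * R + c * (\<Sum>k\<in>UNIV. cmod (A $ l $ k *\<^sub>R (w k t - w l t)))"
      unfolding C_def using amplitude_upper[OF \<open>0 \<le> t\<close>] c_pos
      by (intro add_mono mult_left_mono norm_sum) auto
    finally have "\<bar>(w l t \<bullet> field l t) / cmod (w l t)\<bar> \<le>
        R * \<bar>(cmod (w l t))\<^sup>2 - \<mu>\<bar> + c * (\<Sum>k\<in>UNIV. A $ l $ k * cmod (w k t - w l t))"
      by (simp add: A_nonneg mult.commute)
    then show "\<bar>(w l t \<bullet> field l t) / cmod (w l t) - 0\<bar> \<le>
        1 * \<bar>R * \<bar>(cmod (w l t))\<^sup>2 - \<mu>\<bar> + c * (\<Sum>k\<in>UNIV. A $ l $ k * cmod (w k t - w l t))\<bar>"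
      unfolding diff_zero mult_1 by (rule order_trans[OF _ abs_ge_self])
  qed
qed

end

section \<open>Existence and uniqueness of network solutions\<close>

lemma network_solution_iff_field:
  "network_solution A \<mu> c (\<lambda>_. \<Omega>) J z \<longleftrightarrow> (\<forall>t\<in>J. \<forall>l. (z l has_vector_derivative
     network_field A \<mu> c (\<lambda>k. z k t) l + \<i> * complex_of_real \<Omega> * z l t) (at t within J))"
  by (simp add: network_solution_def network_field_def scaleR_conv_of_real algebra_simps)

lemma network_field_equivariant:
  assumes "cmod u = 1"
  shows "network_field A \<mu> c (\<lambda>k. u * w k) l = u * network_field A \<mu> c w l"
  using assms
  by (simp add: network_field_def norm_mult scaleR_conv_of_real algebra_simps sum_distrib_left sum_subtractf)

text \<open>Multiplication by \<open>cis (s * t)\<close> adds \<open>s\<close> to the common frequency, because the field commutes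
  with rotations.\<close>

lemma network_solution_rotate:
  assumes "network_solution A \<mu> c (\<lambda>_. \<Omega>) J z"
  shows "network_solution A \<mu> c (\<lambda>_. \<Omega> + s) J (\<lambda>l t. cis (s * t) * z l t)"
  unfolding network_solution_iff_field
proof (intro ballI allI)
  fix t l assume "t \<in> J"
  have "((\<lambda>t. exp (\<i> * complex_of_real (s * t))) has_vector_derivative \<i> * s * cis (s * t)) (at t within J)"
    by (auto intro!: derivative_eq_intros has_vector_derivative_real_field simp: cis_conv_exp
        scaleR_conv_of_real)
  then have "((\<lambda>t. cis (s * t)) has_vector_derivative \<i> * s * cis (s * t)) (at t within J)"
    by (simp add: cis_conv_exp)
  moreover have "(z l has_vector_derivative
      network_field A \<mu> c (\<lambda>k. z k t) l + \<i> * complex_of_real \<Omega> * z l t) (at t within J)"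
    using assms \<open>t \<in> J\<close> by (simp add: network_solution_iff_field)
  ultimately have "((\<lambda>t. cis (s * t) * z l t) has_vector_derivative
      cis (s * t) * (network_field A \<mu> c (\<lambda>k. z k t) l + \<i> * complex_of_real \<Omega> * z l t) +
      \<i> * s * cis (s * t) * z l t) (at t within J)"
    by (rule has_vector_derivative_mult)
  then show "((\<lambda>t. cis (s * t) * z l t) has_vector_derivative
      network_field A \<mu> c (\<lambda>k. cis (s * t) * z k t) l +
      \<i> * complex_of_real (\<Omega> + s) * (cis (s * t) * z l t)) (at t within J)"
    unfolding network_field_equivariant[OF norm_cis] by (simp add: algebra_simps)
qed

text \<open>The cubic is the gradient of the convex function \<open>(norm a) ^ 4 / 4\<close>.\<close>

lemma cubic_monotone:
  fixes a b :: "'a::real_inner"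
  shows "0 \<le> (a - b) \<bullet> ((norm a)\<^sup>2 *\<^sub>R a - (norm b)\<^sup>2 *\<^sub>R b)"
proof -
  have "2 * ((a - b) \<bullet> ((norm a)\<^sup>2 *\<^sub>R a - (norm b)\<^sup>2 *\<^sub>R b)) =
      ((norm a)\<^sup>2 + (norm b)\<^sup>2) * (norm (a - b))\<^sup>2 + ((norm a)\<^sup>2 - (norm b)\<^sup>2)\<^sup>2"
    unfolding power2_norm_eq_inner
    by (simp add: algebra_simps inner_commute power2_eq_square)
  also have "\<dots> \<ge> 0" by (intro add_nonneg_nonneg mult_nonneg_nonneg) auto
  finally show ?thesis by simp
qed

text \<open>Only the linear reaction can drive two states apart: the cubic is monotone and the coupling
  dissipates.  This gives uniqueness without any bound on the solutions.\<close>

lemma network_field_one_sided_lipschitz: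
  fixes A :: "real ^ 'n ^ 'n"
  assumes "\<And>l k. A $ l $ k = A $ k $ l" and "\<And>l k. 0 \<le> A $ l $ k" and "0 \<le> c"
  shows "(\<Sum>l\<in>UNIV. (u l - v l) \<bullet> (network_field A \<mu> c u l - network_field A \<mu> c v l))
    \<le> \<mu> * (\<Sum>l\<in>UNIV. (cmod (u l - v l))\<^sup>2)"
proof -
  have "(u l - v l) \<bullet> (network_field A \<mu> c u l - network_field A \<mu> c v l) \<le>
      \<mu> * (cmod (u l - v l))\<^sup>2 +
      c * ((u l - v l) \<bullet> (\<Sum>k\<in>UNIV. A $ l $ k *\<^sub>R ((u k - v k) - (u l - v l))))" for l
  proof -
    have "network_field A \<mu> c u l - network_field A \<mu> c v l = \<mu> *\<^sub>R (u l - v l)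
        - ((cmod (u l))\<^sup>2 *\<^sub>R u l - (cmod (v l))\<^sup>2 *\<^sub>R v l)
        + c *\<^sub>R (\<Sum>k\<in>UNIV. A $ l $ k *\<^sub>R ((u k - v k) - (u l - v l)))"
      by (simp add: network_field_def algebra_simps sum_subtractf sum.distrib)
    then show ?thesis
      using cubic_monotone[of "u l" "v l"]
      by (simp add: inner_add_right inner_diff_right power2_norm_eq_inner)
  qed
  then have "(\<Sum>l\<in>UNIV. (u l - v l) \<bullet> (network_field A \<mu> c u l - network_field A \<mu> c v l)) \<le>
      (\<Sum>l\<in>UNIV. \<mu> * (cmod (u l - v l))\<^sup>2 +
      c * ((u l - v l) \<bullet> (\<Sum>k\<in>UNIV. A $ l $ k *\<^sub>R ((u k - v k) - (u l - v l)))))"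
    by (rule sum_mono)
  also have "\<dots> = \<mu> * (\<Sum>l\<in>UNIV. (cmod (u l - v l))\<^sup>2) +
      c * (\<Sum>l\<in>UNIV. (u l - v l) \<bullet> (\<Sum>k\<in>UNIV. A $ l $ k *\<^sub>R ((u k - v k) - (u l - v l))))"
    by (simp only: sum.distrib sum_distrib_left)
  also have "\<dots> \<le> \<mu> * (\<Sum>l\<in>UNIV. (cmod (u l - v l))\<^sup>2)"
    using coupling_dissipates[OF assms(1,2), of "\<lambda>l. u l - v l"] \<open>0 \<le> c\<close>
    by (simp add: mult_nonneg_nonpos)
  finally show ?thesis .
qed

text \<open>The squared distance \<open>h\<close> satisfies \<open>h' \<le> 2 * \<mu> * h\<close>, so \<open>exp (- 2 * \<mu> * t) * h t\<close> does not increase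
  from its initial value 0.\<close>

lemma network_solution_unique:
  fixes A :: "real ^ 'n ^ 'n"
  assumes sym: "\<And>l k. A $ l $ k = A $ k $ l" and nonneg: "\<And>l k. 0 \<le> A $ l $ k" and "0 \<le> c"
    and J: "is_interval J" "0 \<in> J" "J \<subseteq> {0..}"
    and z: "network_solution A \<mu> c (\<lambda>_. \<Omega>) J z" and v: "network_solution A \<mu> c (\<lambda>_. \<Omega>) J v"
    and init: "\<And>l. z l 0 = v l 0" and "T \<in> J"
  shows "z l T = v l T"
proof -
  have "0 \<le> T" and sub: "{0..T} \<subseteq> J"
    using J \<open>T \<in> J\<close> mem_is_interval_1_I[OF J(1) J(2) \<open>T \<in> J\<close>] by auto
  define h where "h t = (\<Sum>l\<in>UNIV. (cmod (z l t - v l t))\<^sup>2)" for t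
  define F where "F u t l = network_field A \<mu> c (\<lambda>k. u k t) l + \<i> * complex_of_real \<Omega> * u l t"
    for u :: "'n \<Rightarrow> real \<Rightarrow> complex" and t l
  define h' where "h' t = (\<Sum>l\<in>UNIV. 2 * ((z l t - v l t) \<bullet> (F z t l - F v t l)))" for t
  have F_der: "(u l has_vector_derivative F u t l) (at t within {0..T})"
    if u: "network_solution A \<mu> c (\<lambda>_. \<Omega>) J u" and t: "t \<in> {0..T}" for u l t
  proof -
    have "(u l has_vector_derivative F u t l) (at t within J)"
      using u t sub unfolding network_solution_iff_field F_def by blast
    then show ?thesis by (rule has_vector_derivative_within_subset[OF _ sub])
  qed
  have h_der: "(h has_real_derivative h' t) (at t within {0..T})" if "t \<in> {0..T}" for t
    unfolding h_def h'_def
    by (intro DERIV_sum has_real_derivative_norm_square has_vector_derivative_diff F_der z v that)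
  have h'_le: "h' t \<le> 2 * \<mu> * h t" for t
  proof -
    have "(z l t - v l t) \<bullet> (F z t l - F v t l) = (z l t - v l t) \<bullet>
        (network_field A \<mu> c (\<lambda>k. z k t) l - network_field A \<mu> c (\<lambda>k. v k t) l)" for l
      by (simp add: F_def inner_complex_def algebra_simps)
    then have "h' t = 2 * (\<Sum>l\<in>UNIV. (z l t - v l t) \<bullet>
        (network_field A \<mu> c (\<lambda>k. z k t) l - network_field A \<mu> c (\<lambda>k. v k t) l))"
      by (simp add: h'_def sum_distrib_left)
    then show ?thesis
      using network_field_one_sided_lipschitz[OF sym nonneg \<open>0 \<le> c\<close>, of "\<lambda>k. z k t" "\<lambda>k. v k t" \<mu>]
      by (simp add: h_def)
  qed
  have "exp (- (2 * \<mu>) * T) * h T \<le> exp (- (2 * \<mu>) * 0) * h 0"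
  proof (rule nonincreasing_of_deriv_nonpos[OF \<open>0 \<le> T\<close>])
    fix t assume "0 \<le> t" "t \<le> T"
    show "((\<lambda>t. exp (- (2 * \<mu>) * t) * h t) has_real_derivative
        exp (- (2 * \<mu>) * t) * (h' t - 2 * \<mu> * h t)) (at t within {0..T})"
      using \<open>0 \<le> t\<close> \<open>t \<le> T\<close> by (auto intro!: derivative_eq_intros h_der simp: algebra_simps)
    show "exp (- (2 * \<mu>) * t) * (h' t - 2 * \<mu> * h t) \<le> 0"
      using h'_le[of t] by (intro mult_nonneg_nonpos) auto
  qed
  also have "h 0 = 0" by (simp add: h_def init)
  finally have "h T \<le> 0" by (simp add: mult_le_0_iff)
  moreover have "0 \<le> h T" by (simp add: h_def sum_nonneg)
  ultimately have "h T = 0" by simp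
  then show ?thesis by (simp add: h_def sum_nonneg_eq_0_iff)
qed

lemma truncated_cubic_lipschitz:
  fixes a b :: "'a::euclidean_space"
  assumes "0 < r"
  defines "P \<equiv> closest_point (cball 0 r)"
  shows "norm ((norm (P a))\<^sup>2 *\<^sub>R P a - (norm (P b))\<^sup>2 *\<^sub>R P b) \<le> 3 * r\<^sup>2 * norm (a - b)"
proof -
  have "P x \<in> cball 0 r" for x
    unfolding P_def using \<open>0 < r\<close> by (intro closest_point_in_set) auto
  then have P: "norm (P x) \<le> r" for x by simp
  have lip: "norm (P a - P b) \<le> norm (a - b)"
    unfolding P_def using \<open>0 < r\<close> closest_point_lipschitz[of "cball 0 r" a b] by (auto simp: dist_norm)
  have "(norm (P a))\<^sup>2 *\<^sub>R P a - (norm (P b))\<^sup>2 *\<^sub>R P b =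
      (norm (P a))\<^sup>2 *\<^sub>R (P a - P b) + ((norm (P a) - norm (P b)) * (norm (P a) + norm (P b))) *\<^sub>R P b"
    by (simp add: algebra_simps power2_eq_square)
  also have "norm \<dots> \<le> (norm (P a))\<^sup>2 * norm (P a - P b) +
      \<bar>norm (P a) - norm (P b)\<bar> * (norm (P a) + norm (P b)) * norm (P b)"
    by (rule order_trans[OF norm_triangle_ineq]) (simp add: abs_mult)
  also have "\<dots> \<le> r\<^sup>2 * norm (a - b) + norm (a - b) * (r + r) * r"
    using P \<open>0 < r\<close> lip norm_triangle_ineq3[of "P a" "P b"]
    by (intro add_mono mult_mono power_mono order_trans[OF norm_triangle_ineq3 lip] mult_nonneg_nonneg) auto
  finally show ?thesis by (simp add: power2_eq_square algebra_simps)
qed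

text \<open>Projecting each component to the disc of squared radius \<open>N * \<mu>\<close> before the cubic is applied makes the field
  globally Lipschitz.  The energy of its solution stays below \<open>N * \<mu>\<close> by \<open>total_energy_bound\<close>, so
  every component remains in the disc and the projection has no effect.\<close>

lemma network_field_global_solution:
  fixes A :: "real ^ 'n ^ 'n"
  assumes sym: "\<And>l k. A $ l $ k = A $ k $ l" and nonneg: "\<And>l k. 0 \<le> A $ l $ k"
    and "0 < \<mu>" "0 \<le> c" and init: "(\<Sum>l\<in>UNIV. (cmod (a l))\<^sup>2) < real CARD('n) * \<mu>"
  obtains w where "\<And>l. w l 0 = a l" and "\<And>l t. 0 \<le> t \<Longrightarrow>
      (w l has_vector_derivative network_field A \<mu> c (\<lambda>k. w k t) l) (at t within {0..})"
proof -
  define r where "r = sqrt (real CARD('n) * \<mu>)"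
  have r: "0 < r" "r\<^sup>2 = real CARD('n) * \<mu>" using \<open>0 < \<mu>\<close> by (auto simp: r_def)
  define P where "P = closest_point (cball (0 :: complex) r)"
  define G :: "complex ^ 'n \<Rightarrow> complex ^ 'n" where
    "G v = (\<chi> l. \<mu> *\<^sub>R (v $ l) - (cmod (P (v $ l)))\<^sup>2 *\<^sub>R P (v $ l) +
       c *\<^sub>R (\<Sum>k\<in>UNIV. A $ l $ k *\<^sub>R (v $ k - v $ l)))" for v
  define B where "B l = \<mu> + 3 * r\<^sup>2 + c * (\<Sum>k\<in>UNIV. A $ l $ k * 2)" for l
  have lip: "norm (G u - G v) \<le> (\<Sum>l\<in>UNIV. B l) * norm (u - v)" for u v
  proof -
    have "norm ((G u - G v) $ l) \<le> B l * norm (u - v)" for l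
    proof -
      have comp: "cmod (u $ k - v $ k) \<le> norm (u - v)" for k
        using Finite_Cartesian_Product.norm_nth_le[of "u - v" k] by simp
      have "(G u - G v) $ l = \<mu> *\<^sub>R (u $ l - v $ l) -
          ((cmod (P (u $ l)))\<^sup>2 *\<^sub>R P (u $ l) - (cmod (P (v $ l)))\<^sup>2 *\<^sub>R P (v $ l)) +
          c *\<^sub>R (\<Sum>k\<in>UNIV. A $ l $ k *\<^sub>R ((u $ k - v $ k) - (u $ l - v $ l)))"
        by (simp add: G_def algebra_simps sum_subtractf sum.distrib)
      also have "norm \<dots> \<le> norm (\<mu> *\<^sub>R (u $ l - v $ l)) +
          norm ((cmod (P (u $ l)))\<^sup>2 *\<^sub>R P (u $ l) - (cmod (P (v $ l)))\<^sup>2 *\<^sub>R P (v $ l)) +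
          norm (c *\<^sub>R (\<Sum>k\<in>UNIV. A $ l $ k *\<^sub>R ((u $ k - v $ k) - (u $ l - v $ l))))"
        by (intro norm_triangle_mono norm_triangle_ineq4 order_refl)
      also have "\<dots> \<le> \<mu> * norm (u - v) + 3 * r\<^sup>2 * norm (u - v) +
          c * (\<Sum>k\<in>UNIV. A $ l $ k * (norm (u - v) + norm (u - v)))"
      proof (intro add_mono)
        show "norm (\<mu> *\<^sub>R (u $ l - v $ l)) \<le> \<mu> * norm (u - v)" using \<open>0 < \<mu>\<close> comp by simp
        show "norm ((cmod (P (u $ l)))\<^sup>2 *\<^sub>R P (u $ l) - (cmod (P (v $ l)))\<^sup>2 *\<^sub>R P (v $ l))
            \<le> 3 * r\<^sup>2 * norm (u - v)"
          unfolding P_def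
          by (rule order_trans[OF truncated_cubic_lipschitz[OF r(1)] mult_left_mono[OF comp]]) simp
        have "norm (\<Sum>k\<in>UNIV. A $ l $ k *\<^sub>R ((u $ k - v $ k) - (u $ l - v $ l))) \<le>
            (\<Sum>k\<in>UNIV. A $ l $ k * (norm (u - v) + norm (u - v)))"
        proof (rule sum_norm_le)
          fix k
          have "cmod ((u $ k - v $ k) - (u $ l - v $ l)) \<le> norm (u - v) + norm (u - v)"
            using norm_triangle_ineq4[of "u $ k - v $ k" "u $ l - v $ l"] comp[of k] comp[of l] by linarith
          then show "norm (A $ l $ k *\<^sub>R ((u $ k - v $ k) - (u $ l - v $ l))) \<le>
              A $ l $ k * (norm (u - v) + norm (u - v))"
            using nonneg[of l k] by (simp add: mult_left_mono)
        qed
        then show "norm (c *\<^sub>R (\<Sum>k\<in>UNIV. A $ l $ k *\<^sub>R ((u $ k - v $ k) - (u $ l - v $ l)))) \<le>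
            c * (\<Sum>k\<in>UNIV. A $ l $ k * (norm (u - v) + norm (u - v)))"
          using \<open>0 \<le> c\<close> by (simp add: mult_left_mono)
      qed
      also have "\<dots> = B l * norm (u - v)"
        by (simp add: B_def algebra_simps sum_distrib_left sum_distrib_right)
      finally show ?thesis .
    qed
    then have "(\<Sum>l\<in>UNIV. norm ((G u - G v) $ l)) \<le> (\<Sum>l\<in>UNIV. B l * norm (u - v))"
      by (rule sum_mono)
    moreover have "norm (G u - G v) \<le> (\<Sum>l\<in>UNIV. norm ((G u - G v) $ l))"
      unfolding norm_vec_def by (rule L2_set_le_sum) simp
    ultimately show ?thesis by (simp add: sum_distrib_right)
  qed
  have "0 < B l" for l
    unfolding B_def using \<open>0 < \<mu>\<close> \<open>0 \<le> c\<close> nonneg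
    by (intro add_pos_nonneg mult_nonneg_nonneg sum_nonneg) auto
  then have "0 < (\<Sum>l\<in>UNIV. B l)" by (intro sum_pos) auto
  then obtain v where v: "v 0 = (\<chi> l. a l)"
    "\<And>t. 0 \<le> t \<Longrightarrow> (v has_vector_derivative G (v t)) (at t within {0..})"
    using lipschitz_ode_global_solution[OF lip] by metis
  define w where "w l t = v t $ l" for l t
  have w_der: "(w l has_vector_derivative G (v t) $ l) (at t within {0..})" if "0 \<le> t" for l t
    unfolding w_def using bounded_linear.has_vector_derivative[OF bounded_linear_vec_nth v(2)[OF that]] .
  have field: "G (v t) $ l = network_field A \<mu> c (\<lambda>k. w k t) l"
    if "(\<Sum>l\<in>UNIV. (cmod (w l t))\<^sup>2) < real CARD('n) * \<mu>" for t l
  proof -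
    have "(cmod (w l t))\<^sup>2 \<le> (\<Sum>l\<in>UNIV. (cmod (w l t))\<^sup>2)" by (rule member_le_sum) auto
    then have "(cmod (w l t))\<^sup>2 \<le> r\<^sup>2" using that r by simp
    then have "cmod (w l t) \<le> r" using r by (auto intro: power2_le_imp_le)
    then have "P (w l t) = w l t" unfolding P_def by (intro closest_point_self) auto
    then show ?thesis by (simp add: G_def network_field_def w_def algebra_simps)
  qed
  have w0: "w l 0 = a l" for l by (simp add: w_def v)
  have "(\<Sum>l\<in>UNIV. (cmod (w l t))\<^sup>2) < real CARD('n) * \<mu>" if "0 \<le> t" for t
    using init by (intro total_energy_bound[OF sym nonneg \<open>0 < \<mu>\<close> \<open>0 \<le> c\<close> w_der field _ that]) (auto simp: w0)
  note energy = this
  show thesis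
  proof (rule that)
    show "(w l has_vector_derivative network_field A \<mu> c (\<lambda>k. w k t) l) (at t within {0..})"
      if "0 \<le> t" for l t
      using w_der[OF that] field[OF energy[OF that]] by simp
  qed (rule w0)
qed

text \<open>A global solution with the same initial value exists; by uniqueness it agrees with \<open>z\<close> on \<open>J\<close>.\<close>

lemma network_solution_global_extension:
  fixes A :: "real ^ 'n ^ 'n"
  assumes sym: "\<And>l k. A $ l $ k = A $ k $ l" and nonneg: "\<And>l k. 0 \<le> A $ l $ k"
    and "0 < \<mu>" "0 \<le> c" and J: "is_interval J" "0 \<in> J" "J \<subseteq> {0..}"
    and z: "network_solution A \<mu> c (\<lambda>_. \<Omega>) J z"
    and init: "(\<Sum>l\<in>UNIV. (cmod (z l 0))\<^sup>2) < real CARD('n) * \<mu>"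
  shows "\<exists>Z. global_extension A \<mu> c (\<lambda>_. \<Omega>) J z Z"
proof -
  obtain w where w: "\<And>l. w l 0 = z l 0" "\<And>l t. 0 \<le> t \<Longrightarrow>
      (w l has_vector_derivative network_field A \<mu> c (\<lambda>k. w k t) l) (at t within {0..})"
    using network_field_global_solution[OF sym nonneg \<open>0 < \<mu>\<close> \<open>0 \<le> c\<close> init] by blast
  define Z where "Z l t = cis (\<Omega> * t) * w l t" for l t
  have "network_solution A \<mu> c (\<lambda>_. 0) {0..} w" using w(2) by (simp add: network_solution_iff_field)
  from network_solution_rotate[OF this, of \<Omega>]
  have Z: "network_solution A \<mu> c (\<lambda>_. \<Omega>) {0..} Z" by (simp add: Z_def[abs_def])
  then have ZJ: "network_solution A \<mu> c (\<lambda>_. \<Omega>) J Z"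
    using J(3) unfolding network_solution_def by (blast intro: has_vector_derivative_within_subset)
  have "Z l t = z l t" if "t \<in> J" for l t
    by (rule network_solution_unique[OF sym nonneg \<open>0 \<le> c\<close> J ZJ z _ that]) (simp add: Z_def w(1))
  with Z show ?thesis by (auto simp: global_extension_def)
qed

section \<open>Synchronization of the network\<close>

text \<open>The bound \<open>c_star\<close> is chosen so that the level \<open>b\<close> lies below the maximum \<open>2 / 3 * \<mu> * sqrt (\<mu> / 3)\<close>
  of the cubic; hence the set of which \<open>r_star\<close> is the minimum is nonempty.\<close>

lemma r_star_properties:
  fixes A :: "real ^ 'n ^ 'n"
  assumes "0 < \<mu>" "0 < c" "c < c_star A \<mu>"
  shows "0 < lambda_max (laplacian A)" and "0 < r_star A \<mu> c"
    and "\<mu> * r_star A \<mu> c - r_star A \<mu> c ^ 3 =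
      c * sqrt (real CARD('n) * \<mu>) * lambda_max (laplacian A)"
proof -
  define \<Lambda> N where "\<Lambda> = lambda_max (laplacian A)" and "N = real CARD('n)"
  have "0 < N" by (simp add: N_def)
  have "0 < 2 * \<mu> / (3 * sqrt (3 * N) * \<Lambda>)"
    using assms by (simp add: c_star_def \<Lambda>_def N_def)
  then show \<Lambda>: "0 < lambda_max (laplacian A)"
    using \<open>0 < \<mu>\<close> \<open>0 < N\<close> unfolding \<Lambda>_def[symmetric] by (simp add: zero_less_divide_iff zero_less_mult_iff)
  define b where "b = c * sqrt (N * \<mu>) * \<Lambda>"
  have "0 < b" using assms \<Lambda> \<open>0 < N\<close> by (simp add: b_def \<Lambda>_def)
  define X where "X = {x. 0 < x \<and> \<mu> * x - x ^ 3 = b}"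
  \<comment> \<open>The cubic attains its maximum over the positive axis at \<open>s\<close>.\<close>
  define s where "s = sqrt (\<mu> / 3)"
  have s: "0 < s" "\<mu> = 3 * s\<^sup>2" using \<open>0 < \<mu>\<close> by (auto simp: s_def)
  have "b \<le> \<mu> * s - s ^ 3"
  proof -
    have "c * (3 * sqrt (3 * N) * \<Lambda>) < 2 * \<mu>"
      using assms \<Lambda> \<open>0 < N\<close> by (simp add: c_star_def \<Lambda>_def N_def pos_less_divide_eq)
    then have "c * (3 * sqrt (3 * N) * \<Lambda>) * s \<le> 2 * \<mu> * s" using s(1) by simp
    moreover have root: "sqrt (N * \<mu>) = sqrt (3 * N) * s"
      by (simp add: s_def real_sqrt_mult[symmetric])
    ultimately have "3 * b \<le> 2 * \<mu> * s" unfolding b_def root by (simp add: mult_ac)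
    moreover have "3 * (\<mu> * s - s ^ 3) = 2 * \<mu> * s" by (simp add: s(2) power2_eq_square power3_eq_cube)
    ultimately show ?thesis by simp
  qed
  then have "\<exists>x\<ge>0. x \<le> s \<and> \<mu> * x - x ^ 3 = b"
    using \<open>0 < b\<close> s(1) by (intro IVT') (auto intro!: continuous_intros)
  then obtain x where "0 \<le> x" "\<mu> * x - x ^ 3 = b" by blast
  then have "X \<noteq> {}" using \<open>0 < b\<close> by (auto simp: X_def intro!: exI[of _ x] le_neq_trans)
  moreover have "X \<subseteq> {x. poly [:- b, \<mu>, 0, - 1:] x = 0}"
    by (auto simp: X_def algebra_simps power3_eq_cube)
  then have "finite X" by (rule finite_subset) (rule poly_roots_finite, simp)
  ultimately have "Min X \<in> X" by (intro Min_in)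
  moreover have "r_star A \<mu> c = Min X" by (simp add: r_star_def X_def b_def N_def \<Lambda>_def)
  ultimately show "0 < r_star A \<mu> c" "\<mu> * r_star A \<mu> c - r_star A \<mu> c ^ 3 =
      c * sqrt (real CARD('n) * \<mu>) * lambda_max (laplacian A)"
    by (simp_all add: X_def b_def N_def \<Lambda>_def)
qed

text \<open>Two such functions differ by a continuous function with values in the discrete set
  \<open>2 * pi * \<int>\<close>, which must be constant.\<close>

lemma unwrapped_phase_unique:
  fixes a b :: "real \<Rightarrow> real"
  assumes cont: "continuous_on {s..} a" "continuous_on {s..} b"
    and cis: "\<And>t. s \<le> t \<Longrightarrow> cis (a t) = cis (b t)" and init: "a s = b s" and "s \<le> t"
  shows "a t = b t"
proof -
  have int: "\<exists>n :: int. a u - b u = 2 * pi * n" if "s \<le> u" for u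
  proof -
    have "sin (a u) = sin (b u) \<and> cos (a u) = cos (b u)" using cis[OF that] by (simp add: complex_eq_iff)
    then show ?thesis unfolding sin_cos_eq_iff by (auto simp: algebra_simps)
  qed
  have "(\<lambda>u. a u - b u) constant_on {s..}"
  proof (rule continuous_discrete_range_constant)
    fix u assume "u \<in> {s..}"
    have "2 * pi \<le> norm ((a v - b v) - (a u - b u))" if "v \<in> {s..}" "a v - b v \<noteq> a u - b u" for v
    proof -
      obtain m n :: int where mn: "a v - b v = 2 * pi * m" "a u - b u = 2 * pi * n"
        using int \<open>u \<in> {s..}\<close> \<open>v \<in> {s..}\<close> by fastforce
      then have "m \<noteq> n" using that by auto
      then have "1 \<le> \<bar>real_of_int (m - n)\<bar>" by linarith
      then have "2 * pi * 1 \<le> 2 * pi * \<bar>real_of_int (m - n)\<bar>" by (intro mult_left_mono) auto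
      also have "\<dots> = norm ((a v - b v) - (a u - b u))"
        unfolding mn by (simp add: abs_mult flip: right_diff_distrib)
      finally show ?thesis by simp
    qed
    then show "\<exists>e>0. \<forall>v. v \<in> {s..} \<and> a v - b v \<noteq> a u - b u \<longrightarrow> e \<le> norm ((a v - b v) - (a u - b u))"
      by (intro exI[of _ "2 * pi"]) auto
  qed (auto intro!: continuous_intros cont)
  then obtain d where "\<And>u. s \<le> u \<Longrightarrow> a u - b u = d" by (auto simp: constant_on_def)
  from this[of s] this[of t] init \<open>s \<le> t\<close> show ?thesis by simp
qed

lemma time_deriv_eq:
  assumes "(f has_real_derivative D) (at t within {0..})" "0 \<le> t"
  shows "time_deriv f t = D"
proof -
  have "at t within {t<..} \<le> at t within {0..}" using \<open>0 \<le> t\<close> by (intro at_le) auto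
  then have "at t within {0..} \<noteq> bot"
    using trivial_limit_at_right_real[of t] by (metis bot.extremum_uniqueI)
  then show ?thesis
    unfolding time_deriv_def
    using assms by (intro vector_derivative_within) (simp_all add: has_real_derivative_iff_has_vector_derivative)
qed

lemma circle_dist_bounds: "0 \<le> circle_dist \<alpha> \<beta>" "circle_dist \<alpha> \<beta> \<le> \<bar>\<alpha> - \<beta>\<bar>"
proof -
  show "0 \<le> circle_dist \<alpha> \<beta>" unfolding circle_dist_def by (intro cINF_greatest) auto
  have "circle_dist \<alpha> \<beta> \<le> \<bar>\<alpha> - \<beta> + 2 * pi * real_of_int 0\<bar>"
    unfolding circle_dist_def by (intro cINF_lower bdd_belowI2[of _ 0]) auto
  then show "circle_dist \<alpha> \<beta> \<le> \<bar>\<alpha> - \<beta>\<bar>" by simp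
qed

lemma exp_converges_circle_dist:
  assumes "exp_converges (\<lambda>t. f t - g t) 0"
  shows "exp_converges (\<lambda>t. circle_dist (f t) (g t)) 0"
  by (rule exp_converges_bound[OF assms, where K = 1]) (use circle_dist_bounds in auto)

text \<open>The phases \<open>angle l t + \<Omega> * t\<close> are an admissible choice of \<open>\<theta>\<close>, and by
  \<open>unwrapped_phase_unique\<close> the only one for positive amplitudes.  This reduces every claim to the
  convergence results in the rotating frame.\<close>

theorem theorem3p1:
  fixes A :: "real ^ 'n ^ 'n"
    and \<mu> c \<Omega> :: real
    and \<omega> \<theta>0 :: "'n \<Rightarrow> real"
    and J :: "real set"
    and z :: "'n \<Rightarrow> real \<Rightarrow> complex"
  assumes "2 \<le> CARD('n)"
    and "simple_graph_adjacency A" and "graph_connected A"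
    and "0 < \<mu>"
    and "0 < c" and "c < c_star A \<mu>"
    and "\<And>l. \<omega> l = \<Omega>"
    and "is_interval J" and "0 \<in> J" and "J \<subseteq> {0..}"
    and "network_solution A \<mu> c \<omega> J z"
    and "\<And>l. z l 0 = rcis (amplitude z l 0) (\<theta>0 l)"
    and "(\<Sum>l\<in>UNIV. (amplitude z l 0)\<^sup>2) < real CARD('n) * \<mu>"
    and "\<And>l. amplitude z l 0 > r_star A \<mu> c"
    and "\<And>l. 0 < \<theta>0 l" and "\<And>l. \<theta>0 l < pi"
  shows "(\<exists>Z. global_extension A \<mu> c \<omega> J z Z) \<and>
    (\<forall>Z. global_extension A \<mu> c \<omega> J z Z \<longrightarrow>
       (\<forall>t\<ge>0. \<forall>l. 0 < amplitude Z l t) \<and>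
       (\<exists>\<theta>. unwrapped_phases Z \<theta>0 \<theta>) \<and>
       (\<forall>\<theta>. unwrapped_phases Z \<theta>0 \<theta> \<longrightarrow>
          complete_synchronization Z \<theta> \<and>
          exp_complete_synchronization Z \<theta> \<and>
          (\<exists>\<phi>. 0 < \<phi> \<and> \<phi> < pi \<and>
             (\<forall>l k.
                (amplitude Z l \<longlongrightarrow> sqrt \<mu>) at_top \<and>
                ((\<lambda>t. \<bar>time_deriv (amplitude Z l) t - time_deriv (amplitude Z k) t\<bar>) \<longlongrightarrow> 0) at_top \<and>
                ((\<lambda>t. \<bar>time_deriv (\<theta> l) t - time_deriv (\<theta> k) t\<bar>) \<longlongrightarrow> 0) at_top \<and>
                ((\<lambda>t. circle_dist (\<theta> l t - \<Omega> * t) \<phi>) \<longlongrightarrow> 0) at_top) \<and>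
             (\<forall>l. ((\<lambda>t. cmod (Z l t - complex_of_real (sqrt \<mu>) * exp (\<i> * complex_of_real (\<Omega> * t + \<phi>))))
                     \<longlongrightarrow> 0) at_top) \<and>
             (\<forall>l k.
                exp_converges (amplitude Z l) (sqrt \<mu>) \<and>
                exp_converges (\<lambda>t. \<bar>time_deriv (amplitude Z l) t - time_deriv (amplitude Z k) t\<bar>) 0 \<and>
                exp_converges (\<lambda>t. \<bar>time_deriv (\<theta> l) t - time_deriv (\<theta> k) t\<bar>) 0 \<and>
                exp_converges (\<lambda>t. circle_dist (\<theta> l t - \<Omega> * t) \<phi>) 0 \<and>
                exp_converges
                  (\<lambda>t. cmod (Z l t - complex_of_real (sqrt \<mu>) * exp (\<i> * complex_of_real (\<Omega> * t + \<phi>)))) 0))))"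
proof -
  have A: "A $ l $ k = A $ k $ l" "A $ l $ k \<in> {0, 1}" "(l, k) \<in> {(i, j). A $ i $ j = 1}\<^sup>*" for l k
    using assms(2,3) unfolding simple_graph_adjacency_def graph_connected_def by blast+
  have A_nonneg: "0 \<le> A $ l $ k" for l k using A(2)[of l k] by auto
  have \<omega>: "\<omega> = (\<lambda>_. \<Omega>)" using assms(7) by auto
  have rcis0: "z l 0 = rcis (amplitude z l 0) (\<theta>0 l)" for l by (rule assms(12))
  have energy0: "(\<Sum>l\<in>UNIV. (cmod (z l 0))\<^sup>2) < real CARD('n) * \<mu>"
    using assms(13) by (simp add: amplitude_def)
  have amp0: "r_star A \<mu> c < cmod (z l 0)" for l using assms(14)[of l] by (simp add: amplitude_def)
  note rs = r_star_properties[OF assms(4,5,6)]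
  have existence: "\<exists>Z. global_extension A \<mu> c \<omega> J z Z"
    using assms(11) energy0 unfolding \<omega>
    by (intro network_solution_global_extension A(1) A_nonneg assms(4,8,9,10) less_imp_le[OF assms(5)])
  show ?thesis
  proof (intro conjI allI impI existence)
    fix Z assume ext: "global_extension A \<mu> c \<omega> J z Z"
    have Z: "network_solution A \<mu> c (\<lambda>_. \<Omega>) {0..} Z" and Z0: "Z l 0 = z l 0" for l
      using ext assms(9) by (auto simp: global_extension_def \<omega>)
    define w where "w l t = cis (- \<Omega> * t) * Z l t" for l t
    have w0: "w l 0 = z l 0" for l by (simp add: w_def Z0)
    have "network_solution A \<mu> c (\<lambda>_. 0) {0..} w"
      using network_solution_rotate[OF Z, of "- \<Omega>"] by (simp add: w_def[abs_def])
    then have w_der: "(w l has_vector_derivative network_field A \<mu> c (\<lambda>k. w k t) l) (at t within {0..})"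
      if "0 \<le> t" for l t
      using that by (simp add: network_solution_iff_field)
    have "0 < Im (z l 0)" for l
    proof -
      have "Im (z l 0) = cmod (z l 0) * sin (\<theta>0 l)"
        by (subst rcis0) (simp add: amplitude_def)
      also have "0 < \<dots>" using amp0[of l] rs(2) assms(15,16) by (intro mult_pos_pos sin_gt_zero) auto
      finally show ?thesis .
    qed
    then interpret synchronizing_network A \<mu> c "r_star A \<mu> c" w
      by unfold_locales (use A assms rs w_der energy0 amp0 in \<open>auto simp: w0\<close>)
    have amp: "amplitude Z l = (\<lambda>t. cmod (w l t))" for l
      by (auto simp: amplitude_def w_def norm_mult)
    have Zw: "Z l t = cis (\<Omega> * t) * w l t" for l t
      by (simp add: w_def cis_mult flip: mult.assoc)
    have amp_pos: "0 < amplitude Z l t" if "0 \<le> t" for l t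
      using amplitude_lower[OF that, of l] rs(2) unfolding amp by linarith
    define \<Theta> where "\<Theta> l t = angle l t + \<Omega> * t" for l t
    have Z_polar: "Z l t = rcis (amplitude Z l t) (\<Theta> l t)" if "0 \<le> t" for l t
      unfolding Zw \<Theta>_def amp
      by (subst polar_form[OF that]) (simp add: rcis_def cis_mult add.commute mult.left_commute)
    define \<Theta>' where "\<Theta>' l t = - (\<Sum>k\<in>UNIV. weight l k t * (\<rho> k t - \<rho> l t)) / (1 + (\<rho> l t)\<^sup>2) + \<Omega>" for l t
    have \<Theta>_der: "(\<Theta> l has_real_derivative \<Theta>' l t) (at t within {0..})" if "0 \<le> t" for l t
      unfolding \<Theta>_def \<Theta>'_def by (intro DERIV_add angle_der that) (auto intro!: derivative_eq_intros)
    have \<Theta>_init: "\<Theta> l 0 = \<theta>0 l" for l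
    proof -
      have "cmod (z l 0) * cos (\<theta>0 l) = cmod (z l 0) * cos (angle l 0)"
        using rcis0[of l] Z_polar[of 0 l]
        by (metis Re_rcis Z0 \<Theta>_def add.right_neutral amplitude_def mult_zero_right order_refl)
      then have "cos (\<theta>0 l) = cos (angle l 0)" using amp0[of l] rs(2) by auto
      then have "\<theta>0 l = angle l 0"
        using assms(15,16)[of l] angle_range[of l 0] by (auto intro: cos_inj_pi)
      then show ?thesis by (simp add: \<Theta>_def)
    qed
    have \<Theta>_cont: "continuous_on {0..} (\<Theta> l)" for l
      using \<Theta>_der by (auto intro!: DERIV_continuous_on)
    have phases: "unwrapped_phases Z \<theta>0 \<Theta>"
      unfolding unwrapped_phases_def using \<Theta>_cont \<Theta>_init Z_polar by blast
    obtain \<phi> where \<phi>: "0 < \<phi>" "\<phi> < pi" "\<And>l. exp_converges (angle l) \<phi>"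
      "\<And>l. exp_converges (\<lambda>t. cmod (w l t - sqrt \<mu> *\<^sub>R cis \<phi>)) 0"
      using angle_and_state_converge by blast
    have amp_der: "(amplitude Z l has_real_derivative (w l t \<bullet> field l t) / cmod (w l t)) (at t within {0..})"
      if "0 \<le> t" for l t
      unfolding amp by (rule amplitude_der[OF that])
    have E_amp: "exp_converges (amplitude Z l) (sqrt \<mu>)" for l
      unfolding amp by (rule amplitude_converges)
    have E_amp': "exp_converges (time_deriv (amplitude Z l)) 0" for l
    proof (rule exp_converges_bound[OF amplitude_der_converges[of l], where K = 1])
      show "\<bar>time_deriv (amplitude Z l) t - 0\<bar> \<le> 1 * \<bar>(w l t \<bullet> field l t) / cmod (w l t)\<bar>" if "0 \<le> t" for t
        unfolding time_deriv_eq[OF amp_der[OF that] that] by simp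
    qed
    have E_Z: "exp_converges
        (\<lambda>t. cmod (Z l t - complex_of_real (sqrt \<mu>) * exp (\<i> * complex_of_real (\<Omega> * t + \<phi>)))) 0" for l
    proof -
      have "Z l t - complex_of_real (sqrt \<mu>) * exp (\<i> * complex_of_real (\<Omega> * t + \<phi>)) =
          cis (\<Omega> * t) * (w l t - sqrt \<mu> *\<^sub>R cis \<phi>)" for t
        unfolding Zw cis_conv_exp[symmetric]
        by (simp add: cis_mult[symmetric] scaleR_conv_of_real right_diff_distrib)
      then show ?thesis using \<phi>(4)[of l] by (simp add: norm_mult)
    qed
    have amp_diff: "exp_converges (\<lambda>t. \<bar>time_deriv (amplitude Z l) t - time_deriv (amplitude Z k) t\<bar>) 0" for l k
      unfolding exp_converges_abs_iff by (rule exp_converges_diff[OF E_amp' E_amp'])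
    have sync: "exp_complete_synchronization Z \<theta>"
      "exp_converges (\<lambda>t. circle_dist (\<theta> l t - \<Omega> * t) \<phi>) 0"
      if \<theta>: "unwrapped_phases Z \<theta>0 \<theta>" for \<theta> l
    proof -
      have eq: "\<theta> l t = \<Theta> l t" if "0 \<le> t" for l t
      proof (rule unwrapped_phase_unique[OF _ \<Theta>_cont _ _ that])
        fix t :: real assume "0 \<le> t"
        then have "rcis (amplitude Z l t) (\<theta> l t) = rcis (amplitude Z l t) (\<Theta> l t)"
          using \<theta> Z_polar unfolding unwrapped_phases_def by metis
        then show "cis (\<theta> l t) = cis (\<Theta> l t)"
          using amp_pos[OF \<open>0 \<le> t\<close>, of l] by (simp add: rcis_def)
      qed (use \<theta> \<Theta>_init in \<open>auto simp: unwrapped_phases_def\<close>)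
      have \<theta>_der: "(\<theta> l has_real_derivative \<Theta>' l t) (at t within {0..})" if "0 \<le> t" for l t
        using \<Theta>_der[OF that, of l] that eq
        unfolding has_real_derivative_iff_has_vector_derivative
        by (intro has_vector_derivative_transform[of t "{0..}" "\<theta> l" "\<Theta> l"]) auto
      have E_\<theta>': "exp_converges (time_deriv (\<theta> l)) \<Omega>" for l
      proof (rule exp_converges_bound[OF angle_der_converges[of l], where K = 1])
        show "\<bar>time_deriv (\<theta> l) t - \<Omega>\<bar> \<le> 1 *
            \<bar>- (\<Sum>k\<in>UNIV. weight l k t * (\<rho> k t - \<rho> l t)) / (1 + (\<rho> l t)\<^sup>2)\<bar>" if "0 \<le> t" for t
          unfolding time_deriv_eq[OF \<theta>_der[OF that] that] by (simp add: \<Theta>'_def)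
      qed
      have E_\<theta>: "exp_converges (\<lambda>t. \<theta> l t - \<Omega> * t) \<phi>" for l
        by (rule exp_converges_bound[where K = 1 and g = "\<lambda>t. angle l t - \<phi>"])
           (use \<phi>(3)[of l] in \<open>auto simp: exp_converges_def eq \<Theta>_def\<close>)
      have E_\<theta>\<theta>: "exp_converges (\<lambda>t. \<theta> l t - \<theta> k t) 0" for l k
        using exp_converges_diff[OF E_\<theta>[of l] E_\<theta>[of k]] by simp
      show "exp_converges (\<lambda>t. circle_dist (\<theta> l t - \<Omega> * t) \<phi>) 0"
        using E_\<theta>[of l] by (intro exp_converges_circle_dist) (simp add: exp_converges_def)
      have E: "exp_converges (\<lambda>t. \<bar>amplitude Z l t - amplitude Z k t\<bar>) 0"
        "exp_converges (\<lambda>t. \<bar>time_deriv (amplitude Z l) t - time_deriv (amplitude Z k) t\<bar>) 0"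
        "exp_converges (\<lambda>t. \<bar>time_deriv (\<theta> l) t - time_deriv (\<theta> k) t\<bar>) 0"
        "exp_converges (\<lambda>t. circle_dist (\<theta> l t) (\<theta> k t)) 0" for l k
        unfolding exp_converges_abs_iff
        by (intro exp_converges_diff[OF E_amp E_amp] exp_converges_diff[OF E_amp' E_amp']
            exp_converges_diff[OF E_\<theta>' E_\<theta>'] exp_converges_circle_dist[OF E_\<theta>\<theta>])+
      have "polar_regular Z \<theta>"
        unfolding polar_regular_def
        using amp_pos amp_der \<theta>_der unfolding has_field_derivative_def differentiable_def by blast
      then have "complete_synchronization Z \<theta>"
        unfolding complete_synchronization_def using E[THEN exp_converges_imp_tendsto] by blast
      then show "exp_complete_synchronization Z \<theta>"
        unfolding exp_complete_synchronization_def using E by blast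
    qed
    show "0 < amplitude Z l t" if "0 \<le> t" for l t by (rule amp_pos[OF that])
    show "\<exists>\<theta>. unwrapped_phases Z \<theta>0 \<theta>" using phases by blast
    fix \<theta> assume \<theta>: "unwrapped_phases Z \<theta>0 \<theta>"
    show "exp_complete_synchronization Z \<theta>" by (rule sync(1)[OF \<theta>])
    then show "complete_synchronization Z \<theta>" by (simp add: exp_complete_synchronization_def)
    have "exp_converges (\<lambda>t. \<bar>time_deriv (\<theta> l) t - time_deriv (\<theta> k) t\<bar>) 0" for l k
      using sync(1)[OF \<theta>] by (simp add: exp_complete_synchronization_def)
    note conv = E_amp amp_diff this sync(2)[OF \<theta>] E_Z
    show "\<exists>\<phi>. 0 < \<phi> \<and> \<phi> < pi \<and>
             (\<forall>l k.
                (amplitude Z l \<longlongrightarrow> sqrt \<mu>) at_top \<and>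
                ((\<lambda>t. \<bar>time_deriv (amplitude Z l) t - time_deriv (amplitude Z k) t\<bar>) \<longlongrightarrow> 0) at_top \<and>
                ((\<lambda>t. \<bar>time_deriv (\<theta> l) t - time_deriv (\<theta> k) t\<bar>) \<longlongrightarrow> 0) at_top \<and>
                ((\<lambda>t. circle_dist (\<theta> l t - \<Omega> * t) \<phi>) \<longlongrightarrow> 0) at_top) \<and>
             (\<forall>l. ((\<lambda>t. cmod (Z l t - complex_of_real (sqrt \<mu>) * exp (\<i> * complex_of_real (\<Omega> * t + \<phi>))))
                     \<longlongrightarrow> 0) at_top) \<and>
             (\<forall>l k.
                exp_converges (amplitude Z l) (sqrt \<mu>) \<and>
                exp_converges (\<lambda>t. \<bar>time_deriv (amplitude Z l) t - time_deriv (amplitude Z k) t\<bar>) 0 \<and>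
                exp_converges (\<lambda>t. \<bar>time_deriv (\<theta> l) t - time_deriv (\<theta> k) t\<bar>) 0 \<and>
                exp_converges (\<lambda>t. circle_dist (\<theta> l t - \<Omega> * t) \<phi>) 0 \<and>
                exp_converges
                  (\<lambda>t. cmod (Z l t - complex_of_real (sqrt \<mu>) * exp (\<i> * complex_of_real (\<Omega> * t + \<phi>)))) 0)"
      by (intro exI[of _ \<phi>] conjI allI \<phi>(1,2) conv conv[THEN exp_converges_imp_tendsto])
  qed
qed

end
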